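(* Let $\rho\in[0,1)$ and $M>0$ be given. There exists a unique family of coefficients $\{a_n\}_{n\in\mathbb Z}$ solving $$a_{n+1}=\zeta_{n,\rho}\,a_n^2\quad (n\in\mathbb Z),\qquad \zeta_{n,\rho}:=\frac{\ln2}{2^{n+\rho}}\,\frac{k(2^{n+\rho})}{\gamma(2^{n+\rho+1})},$$ which are positive, bounded, and satisfy $$\sum_{n=-\infty}^\infty2^{n+\rho}a_n=M.$$ Furthermore, there exist two constants $A_0\in\mathbb R$, $A_M>0$, uniquely determined by $M$, such that $$a_n=a_{-\infty}\bigl(2^n+A_02^{2n}\bigr)+o(2^{2n})\quad\text{as }n\to-\infty,\qquad a_n\sim a_\infty2^{(\beta-\alpha)n}e^{-A_M2^n}\quad\text{as }n\to\infty,$$ where $a_{-\infty}:=\frac{\gamma_02^{\rho+1}}{k_0\ln2}$ and $a_\infty:=(\ln2)^{-1}2^\beta2^{(\beta-\alpha)(\rho+1)}$. In particular, the measure $g_p:=\sum_{n=-\infty}^\infty a_n\delta(x-n-\rho)$ (where $\delta(x-n-\rho)$ is the unit Dirac mass at $n+\rho$) is a stationary solution of the coagulation-fragmentation equation in logarithmic variables (in the weak sense) with total mass $M$, that is, $\int_{\mathbb R}2^xg_p(x)\,dx=\sum_{n=-\infty}^\infty2^{n+\rho}a_n=M$.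
   Context: Kernels (fixed throughout). Let $\alpha\in(0,1)$, $\beta\in(1,2)$, $\bar\alpha,\bar\beta>1$, $k_0,\gamma_0>0$. The coagulation kernel is $$K(\xi,\eta)=\frac1{\xi+\eta}\,k\Bigl(\frac{\xi+\eta}2\Bigr)Q\Bigl(\frac{2\eta}{\xi+\eta}-1\Bigr),$$ where $k\in C([0,\infty))$, $k>0$, $k(\xi)\sim\xi^{\alpha+1}$ (ratio tending to $1$) as $\xi\to\infty$, $k(\xi)=k_0+O(\xi^{\bar\alpha})$ as $\xi\to0^+$, and $Q\in C(\mathbb R)$, $Q\ge0$, $Q(0)=1$, $\operatorname{supp}Q\subset(-\frac13,\frac13)$, $Q$ even. The fragmentation kernel is $\Gamma(\xi,\eta)=\gamma(\xi)\delta(\xi-2\eta)$, where $\gamma\in C((0,\infty))$, $\gamma>0$, $\gamma(\xi)\sim\xi^\beta$ as $\xi\to\infty$, $\gamma(\xi)=\gamma_0+O(\xi^{\bar\beta})$ as $\xi\to0^+$. Weak solutions in logarithmic variables. Integration against a measure $g$ is written $\int\phi(x)g(x)\,dx$ even if $g$ is not absolutely continuous; $\int F(y+1)g(y+1)\,dy$ means $\int F(x)g(x)\,dx$. Let $\mathcal M_+(\mathbb R;1+2^{(\beta+1)x})$ be the set of positive Radon measures $g$ on $\mathbb R$ with $\int_{\mathbb R}(1+2^{(\beta+1)x})g(x)\,dx<\infty$. A map $g\in C([0,T];\mathcal M_+(\mathbb R;1+2^{(\beta+1)x}))$ is a weak solution in $[0,T]$ with initial datum $g_0$ if $g(\cdot,0)=g_0$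 and for every $t\in[0,T]$ $$\partial_t\Bigl(\int_{\mathbb R}g(x,t)\varphi(x)\,dx\Bigr)=\frac{\ln2}2\int_{\mathbb R}\int_{\mathbb R}K(2^y,2^z)g(y,t)g(z,t)\Bigl[\varphi\Bigl(\frac{\ln(2^y+2^z)}{\ln2}\Bigr)-\varphi(y)-\varphi(z)\Bigr]dy\,dz-\frac14\int_{\mathbb R}\gamma(2^{y+1})g(y+1,t)\bigl[\varphi(y+1)-2\varphi(y)\bigr]dy$$ for every $\varphi\in C(\mathbb R)$ such that $\lim_{x\to-\infty}\varphi(x)$ exists and is finite and $|\varphi(x)|\lesssim2^x$ as $x\to\infty$. A stationary solution is a measure $g_p$ such that the constant-in-time map $t\mapsto g_p$ is a weak solution (on every $[0,T]$). *)

theory Defs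
  imports "HOL-Analysis.Analysis" "HOL-Library.Landau_Symbols"
begin

definition coag_kernel :: "(real \<Rightarrow> real) \<Rightarrow> (real \<Rightarrow> real) \<Rightarrow> real \<Rightarrow> real \<Rightarrow> real" where
  "coag_kernel k Q \<xi> \<eta> =
     1 / (\<xi> + \<eta>) * k ((\<xi> + \<eta>) / 2) * Q (2 * \<eta> / (\<xi> + \<eta>) - 1)"

text \<open>
  The positive Radon measures on the line with finite integral of \<open>1 + 2\<^sup>(\<^sup>\<beta>\<^sup>+\<^sup>1\<^sup>)\<^sup>x\<close>.
  Such a measure is finite, and every finite Borel measure on the line is Radon, so
  no separate regularity condition is needed.
\<close>

definition weight :: "real \<Rightarrow> real \<Rightarrow> real" where
  "weight \<beta> x = 1 + 2 powr ((\<beta> + 1) * x)"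

definition weighted_measures :: "real \<Rightarrow> real measure set" where
  "weighted_measures \<beta> =
     {g. sets g = sets borel \<and> (\<integral>\<^sup>+ x. ennreal (weight \<beta> x) \<partial>g) < \<infinity>}"

text \<open>
  Continuity in time with values in the weighted measures refers to the weak topology:
  the one induced by integration against the continuous functions that are dominated
  by the weight.
\<close>

definition weakly_continuous_on ::
  "real \<Rightarrow> real set \<Rightarrow> (real \<Rightarrow> real measure) \<Rightarrow> bool" where
  "weakly_continuous_on \<beta> I g \<longleftrightarrow>
     (\<forall>\<psi>. continuous_on UNIV \<psi> \<longrightarrow> (\<exists>C. \<forall>x. \<bar>\<psi> x\<bar> \<le> C * weight \<beta> x) \<longrightarrow>
        continuous_on I (\<lambda>t. LINT x|g t. \<psi> x))"

definition test_function :: "(real \<Rightarrow> real) \<Rightarrow> bool" where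
  "test_function \<phi> \<longleftrightarrow>
     continuous_on UNIV \<phi> \<and> (\<exists>l. (\<phi> \<longlongrightarrow> l) at_bot) \<and> \<phi> \<in> O[at_top](\<lambda>x. 2 powr x)"

definition coag_integrand ::
  "(real \<Rightarrow> real) \<Rightarrow> (real \<Rightarrow> real) \<Rightarrow> (real \<Rightarrow> real) \<Rightarrow> real \<times> real \<Rightarrow> real" where
  "coag_integrand k Q \<phi> = (\<lambda>(y, z).
     coag_kernel k Q (2 powr y) (2 powr z) *
       (\<phi> (ln (2 powr y + 2 powr z) / ln 2) - \<phi> y - \<phi> z))"

text \<open>
  In the fragmentation term, \<open>\<integral> F (y + 1) g (y + 1) dy\<close> stands for the integral of
  \<open>F\<close> against \<open>g\<close>; in the variable \<open>x = y + 1\<close> the integrand is the following.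
\<close>

definition frag_integrand :: "(real \<Rightarrow> real) \<Rightarrow> (real \<Rightarrow> real) \<Rightarrow> real \<Rightarrow> real" where
  "frag_integrand \<gamma> \<phi> x = \<gamma> (2 powr x) * (\<phi> x - 2 * \<phi> (x - 1))"

text \<open>
  Weak solutions on \<open>[0, T]\<close>. The time derivative is one-sided at \<open>0\<close> and \<open>T\<close>.
  Since \<open>K(2\<^sup>y, 2\<^sup>y)\<close> grows like \<open>2\<^sup>-\<^sup>y\<close> as \<open>y \<rightarrow> -\<infinity>\<close>, the coagulation term need not
  converge for all measures in the space, and the Bochner integral of a non-integrable
  function is \<open>0\<close>; absolute convergence of the integrals is therefore part of the
  definition.
\<close>

definition weak_solution ::
  "(real \<Rightarrow> real) \<Rightarrow> (real \<Rightarrow> real) \<Rightarrow> (real \<Rightarrow> real) \<Rightarrow> real \<Rightarrow> real \<Rightarrow>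
     real measure \<Rightarrow> (real \<Rightarrow> real measure) \<Rightarrow> bool" where
  "weak_solution k Q \<gamma> \<beta> T g0 g \<longleftrightarrow>
     (\<forall>t\<in>{0..T}. g t \<in> weighted_measures \<beta>) \<and>
     weakly_continuous_on \<beta> {0..T} g \<and>
     g 0 = g0 \<and>
     (\<forall>t\<in>{0..T}. \<forall>\<phi>. test_function \<phi> \<longrightarrow>
        integrable (g t \<Otimes>\<^sub>M g t) (coag_integrand k Q \<phi>) \<and>
        integrable (g t) (frag_integrand \<gamma> \<phi>) \<and>
        ((\<lambda>s. LINT x|g s. \<phi> x) has_real_derivative
           ln 2 / 2 * (LINT p|(g t \<Otimes>\<^sub>M g t). coag_integrand k Q \<phi> p)
             - 1 / 4 * (LINT x|g t. frag_integrand \<gamma> \<phi> x))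
          (at t within {0..T}))"

definition stationary_solution ::
  "(real \<Rightarrow> real) \<Rightarrow> (real \<Rightarrow> real) \<Rightarrow> (real \<Rightarrow> real) \<Rightarrow> real \<Rightarrow> real measure \<Rightarrow> bool" where
  "stationary_solution k Q \<gamma> \<beta> g \<longleftrightarrow> (\<forall>T>0. weak_solution k Q \<gamma> \<beta> T g (\<lambda>_. g))"

definition zeta :: "(real \<Rightarrow> real) \<Rightarrow> (real \<Rightarrow> real) \<Rightarrow> real \<Rightarrow> int \<Rightarrow> real" where
  "zeta k \<gamma> \<rho> n =
     ln 2 / 2 powr (real_of_int n + \<rho>) *
       (k (2 powr (real_of_int n + \<rho>)) / \<gamma> (2 powr (real_of_int n + \<rho> + 1)))"

definition coefficient_family ::
  "(real \<Rightarrow> real) \<Rightarrow> (real \<Rightarrow> real) \<Rightarrow> real \<Rightarrow> real \<Rightarrow> (int \<Rightarrow> real) \<Rightarrow> bool" where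
  "coefficient_family k \<gamma> \<rho> M a \<longleftrightarrow>
     (\<forall>n. a (n + 1) = zeta k \<gamma> \<rho> n * (a n)\<^sup>2) \<and>
     (\<forall>n. a n > 0) \<and>
     bounded (range a) \<and>
     ((\<lambda>n. 2 powr (real_of_int n + \<rho>) * a n) has_sum M) UNIV"

definition a_minus_infty :: "real \<Rightarrow> real \<Rightarrow> real \<Rightarrow> real" where
  "a_minus_infty k0 \<gamma>0 \<rho> = \<gamma>0 * 2 powr (\<rho> + 1) / (k0 * ln 2)"

definition a_infty :: "real \<Rightarrow> real \<Rightarrow> real \<Rightarrow> real" where
  "a_infty \<alpha> \<beta> \<rho> = inverse (ln 2) * 2 powr \<beta> * 2 powr ((\<beta> - \<alpha>) * (\<rho> + 1))"

text \<open>
  The measure \<open>\<Sum>n. a n \<delta>(x - n - \<rho>)\<close>, as the image under \<open>n \<mapsto> n + \<rho>\<close> of the measure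
  on the integers with point masses \<open>a n\<close>; the lemma gives its values.
\<close>

definition dirac_comb :: "real \<Rightarrow> (int \<Rightarrow> real) \<Rightarrow> real measure" where
  "dirac_comb \<rho> a =
     distr (density (count_space UNIV) (\<lambda>n. ennreal (a n))) borel (\<lambda>n. real_of_int n + \<rho>)"

lemma emeasure_dirac_comb:
  assumes "A \<in> sets borel"
  shows "emeasure (dirac_comb \<rho> a) A =
    (\<integral>\<^sup>+ n. ennreal (a n) * indicator A (real_of_int n + \<rho>) \<partial>count_space UNIV)"
proof -
  have "emeasure (dirac_comb \<rho> a) A =
      emeasure (density (count_space UNIV) (\<lambda>n. ennreal (a n)))
        ((\<lambda>n. real_of_int n + \<rho>) -` A)"
    unfolding dirac_comb_def using assms by (subst emeasure_distr) auto
  also have "\<dots> =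
      (\<integral>\<^sup>+ n. ennreal (a n) * indicator A (real_of_int n + \<rho>) \<partial>count_space UNIV)"
    by (subst emeasure_density) (auto intro!: nn_integral_cong split: split_indicator)
  finally show ?thesis .
qed

end

theory Submission
  imports Defs "HOL-Real_Asymp.Real_Asymp"
begin

text \<open>
  Taking logarithms turns the recursion \<open>a (n + 1) = \<zeta> n * (a n)\<^sup>2\<close> into a linear one, and
  \<open>ln (a n) / 2\<^sup>n\<close> then has the increments \<open>ln (\<zeta> n) / 2\<^sup>n\<^sup>+\<^sup>1\<close>, which do not involve \<open>a\<close>. Hence a
  positive solution \<open>p\<close> exists, and every other one is \<open>p n * exp (s * 2\<^sup>n)\<close> for some real \<open>s\<close>
  (\<open>solutions_differ_by_rescaling\<close>).

  Both expansions follow from the same device. Divide \<open>a\<close> by the pure exponential solving the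
  recursion whose \<open>\<zeta>\<close> is the leading term of the true one. The increments of \<open>ln (\<dots>) / 2\<^sup>n\<close>
  are now \<open>\<epsilon> n / 2\<^sup>n\<^sup>+\<^sup>1\<close> with \<open>\<epsilon> n\<close> the relative error in \<open>\<zeta>\<close> (to first order). As \<open>n \<rightarrow> \<infinity>\<close>,
  \<open>\<epsilon> n \<rightarrow> 0\<close> makes the sequence converge to a limit \<open>L\<close> with remainder \<open>o(2\<^sup>-\<^sup>n)\<close>, and
  exponentiating gives \<open>exp (L * 2\<^sup>n)\<close> up to a factor tending to \<open>1\<close> (\<open>solution_at_top\<close>). As
  \<open>n \<rightarrow> -\<infinity>\<close>, \<open>\<epsilon> n\<close> decays like \<open>2\<^sup>q\<^sup>n\<close> with \<open>q > 1\<close>, which beats the factor \<open>2\<^sup>-\<^sup>n\<close>, so the sequence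
  converges there too, and its limit is \<open>A0\<close> (\<open>solution_at_bot\<close>).

  Normalise \<open>p\<close> so that its \<open>L\<close> is \<open>0\<close>. The leading exponential grows at \<open>\<infinity>\<close> because
  \<open>\<beta> > \<alpha>\<close>, so \<open>p n * exp (s * 2\<^sup>n)\<close> is bounded exactly when \<open>s < 0\<close>, and then it decays
  superexponentially. Its mass is continuous and strictly increasing in \<open>s < 0\<close>, with limits
  \<open>0\<close> and \<open>\<infinity>\<close> at the ends, and so takes the value \<open>M\<close> exactly once
  (\<open>unique_bounded_solution_of_given_mass\<close>).

  For stationarity, distinct points of the lattice \<open>\<int> + \<rho>\<close> correspond to sizes differing by a
  factor of at least \<open>2\<close>, where the support condition on \<open>Q\<close> makes the coagulation kernel vanish. Only
  equal sizes coagulate, and they move mass from \<open>n + \<rho>\<close> to \<open>n + 1 + \<rho>\<close>, just as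
  fragmentation moves it back. The recursion is the balance of these two fluxes for each pair of
  neighbours, and the sum of the balances is the weak equation (\<open>dirac_comb_stationary\<close>).
\<close>

section \<open>Sequences indexed by the integers\<close>

lemma eventually_at_top_int:
  "eventually P (at_top :: int filter) \<longleftrightarrow> eventually (\<lambda>n. P (int n)) sequentially"
proof
  assume "eventually (\<lambda>n. P (int n)) sequentially"
  then obtain N where "\<And>n. n \<ge> N \<Longrightarrow> P (int n)"
    by (auto simp: eventually_sequentially)
  then have "P m" if "m \<ge> int N" for m
    using that by (metis nat_int_comparison(3) int_nat_eq nat_le_iff of_nat_0_le_iff order_trans le_nat_iff)
  then show "eventually P at_top"
    by (auto simp: eventually_at_top_linorder)
qed (use filterlim_int_sequentially in \<open>auto simp: filterlim_iff\<close>)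

lemma at_bot_int_mirror: "(at_bot :: int filter) = filtermap uminus at_top"
proof (rule filter_eqI)
  fix P :: "int \<Rightarrow> bool"
  have "(\<exists>N. \<forall>n\<le>N. P n) \<longleftrightarrow> (\<exists>N. \<forall>n\<ge>N. P (- n))"
    by (metis minus_le_iff minus_minus le_minus_iff)
  then show "eventually P at_bot \<longleftrightarrow> eventually P (filtermap uminus at_top)"
    by (simp add: eventually_filtermap eventually_at_top_linorder eventually_at_bot_linorder)
qed

lemma eventually_at_bot_int:
  "eventually P (at_bot :: int filter) \<longleftrightarrow> eventually (\<lambda>n. P (- int n)) sequentially"
  by (simp add: at_bot_int_mirror eventually_filtermap eventually_at_top_int)

lemma filterlim_at_top_int_iff:
  "filterlim f F (at_top :: int filter) \<longleftrightarrow> filterlim (\<lambda>n. f (int n)) F sequentially"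
  by (simp add: filterlim_iff eventually_at_top_int)

lemma filterlim_at_bot_int_iff:
  "filterlim f F (at_bot :: int filter) \<longleftrightarrow> filterlim (\<lambda>n. f (- int n)) F sequentially"
  by (simp add: filterlim_iff eventually_at_bot_int)

lemma telescope_dyadic:
  fixes X :: "nat \<Rightarrow> real"
  assumes "\<And>n. n \<ge> N \<Longrightarrow> \<bar>X (Suc n) - X n\<bar> \<le> e / 2 ^ n" and "n \<ge> N"
  shows "\<bar>X (n + m) - X n\<bar> \<le> 2 * e / 2 ^ n - 2 * e / 2 ^ (n + m)"
proof (induction m)
  case (Suc m)
  have "\<bar>X (n + Suc m) - X n\<bar> \<le> e / 2 ^ (n + m) + \<bar>X (n + m) - X n\<bar>"
    using assms(1)[of "n + m"] \<open>n \<ge> N\<close> by simp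
  also have "\<dots> \<le> e / 2 ^ (n + m) + (2 * e / 2 ^ n - 2 * e / 2 ^ (n + m))"
    using Suc by simp
  also have "\<dots> = 2 * e / 2 ^ n - 2 * e / 2 ^ (n + Suc m)"
    by (simp add: field_simps)
  finally show ?case .
qed simp

text \<open>
  The tail of the telescoping series is \<open>\<Sum>j\<ge>n. o(2\<^sup>-\<^sup>j) = o(2\<^sup>-\<^sup>n)\<close>. It is the rate of
  convergence, not convergence alone, that makes \<open>exp (2\<^sup>n * u n)\<close> asymptotic to
  \<open>exp (2\<^sup>n * L)\<close>.
\<close>

lemma dyadic_limit_at_top:
  fixes u :: "int \<Rightarrow> real"
  assumes "((\<lambda>n. (u (n + 1) - u n) * 2 powr n) \<longlongrightarrow> 0) at_top"
  shows "\<exists>L. ((\<lambda>n. (u n - L) * 2 powr n) \<longlongrightarrow> 0) at_top"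
proof -
  define X where "X n = u (int n)" for n
  have lim: "(\<lambda>n. (X (Suc n) - X n) * 2 ^ n) \<longlonglongrightarrow> 0"
    using assms by (simp add: filterlim_at_top_int_iff X_def powr_realpow algebra_simps)
  have small: "\<exists>N. \<forall>n\<ge>N. \<forall>m. \<bar>X (n + m) - X n\<bar> \<le> e / 2 ^ n" if "e > 0" for e
  proof -
    have "eventually (\<lambda>n. \<bar>(X (Suc n) - X n) * 2 ^ n\<bar> < e / 2) sequentially"
      using tendstoD[OF lim, of "e / 2"] that by simp
    then obtain N where N: "\<And>n. n \<ge> N \<Longrightarrow> \<bar>X (Suc n) - X n\<bar> \<le> (e / 2) / 2 ^ n"
      unfolding eventually_sequentially abs_mult
      by (metis (no_types, lifting) abs_of_pos less_imp_le pos_le_divide_eq zero_less_numeral zero_less_power)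
    have "\<bar>X (n + m) - X n\<bar> \<le> e / 2 ^ n" if "n \<ge> N" for n m
    proof -
      have "\<bar>X (n + m) - X n\<bar> \<le> e / 2 ^ n - e / 2 ^ (n + m)"
        using telescope_dyadic[of N X "e / 2" n m, OF N that] by simp
      moreover have "e / 2 ^ (n + m) \<ge> 0"
        using \<open>e > 0\<close> by simp
      ultimately show ?thesis by linarith
    qed
    then show ?thesis by blast
  qed
  have "Cauchy X"
  proof (rule metric_CauchyI)
    fix e :: real assume "e > 0"
    then obtain N where N: "\<And>n m. n \<ge> N \<Longrightarrow> \<bar>X (n + m) - X n\<bar> \<le> (e / 3) / 2 ^ n"
      using small[of "e / 3"] by auto
    have near: "\<bar>X n - X N\<bar> \<le> e / 3" if "n \<ge> N" for n
    proof -
      have "\<bar>X n - X N\<bar> \<le> (e / 3) / 2 ^ N"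
        using N[of N "n - N"] that by simp
      also have "\<dots> \<le> e / 3"
        using \<open>e > 0\<close> by (intro divide_le_eq[THEN iffD2]) (simp_all add: mult_le_cancel_left1)
      finally show ?thesis .
    qed
    have "dist (X m) (X n) < e" if "m \<ge> N" "n \<ge> N" for m n
      using near[OF that(1)] near[OF that(2)] \<open>e > 0\<close> unfolding dist_real_def by linarith
    then show "\<exists>N. \<forall>m\<ge>N. \<forall>n\<ge>N. dist (X m) (X n) < e" by blast
  qed
  then obtain L where L: "X \<longlonglongrightarrow> L"
    using Cauchy_convergent_iff convergent_def by blast
  have "(\<lambda>n. (X n - L) * 2 ^ n) \<longlonglongrightarrow> 0"
  proof (rule tendstoI)
    fix e :: real assume "e > 0"
    then obtain N where N: "\<And>n m. n \<ge> N \<Longrightarrow> \<bar>X (n + m) - X n\<bar> \<le> (e / 2) / 2 ^ n"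
      using small[of "e / 2"] by auto
    have "dist ((X n - L) * 2 ^ n) 0 < e" if "n \<ge> N" for n
    proof -
      have "(\<lambda>m. \<bar>X (n + m) - X n\<bar>) \<longlonglongrightarrow> \<bar>L - X n\<bar>"
        using LIMSEQ_ignore_initial_segment[OF L, of n] by (intro tendsto_intros) (simp add: add.commute)
      then have "\<bar>L - X n\<bar> \<le> (e / 2) / 2 ^ n"
        using N[OF that] by (intro LIMSEQ_le_const2) auto
      then have "\<bar>L - X n\<bar> * 2 ^ n \<le> e / 2"
        by (simp add: field_simps)
      then show ?thesis
        using \<open>e > 0\<close> by (simp add: abs_mult abs_minus_commute)
    qed
    then show "eventually (\<lambda>n. dist ((X n - L) * 2 ^ n) 0 < e) sequentially"
      by (auto simp: eventually_sequentially)
  qed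
  then show ?thesis
    by (auto simp: filterlim_at_top_int_iff X_def powr_realpow)
qed

lemma geometric_increments_converge_at_bot:
  fixes u :: "int \<Rightarrow> real"
  assumes "(\<lambda>n. u (n + 1) - u n) \<in> O[at_bot](\<lambda>n. 2 powr (c * n))" and "c > 0"
  shows "\<exists>L. (u \<longlongrightarrow> L) at_bot"
proof -
  define X where "X n = u (- int n)" for n
  from assms(1) obtain C where "C > 0" and
    "eventually (\<lambda>n. \<bar>u (n + 1) - u n\<bar> \<le> C * 2 powr (c * n)) at_bot"
    by (auto elim!: landau_o.bigE)
  then have "eventually (\<lambda>n. \<bar>u (- int n + 1) - u (- int n)\<bar> \<le> C * 2 powr (c * - real n)) sequentially"
    by (simp add: eventually_at_bot_int)
  then have "eventually (\<lambda>n. \<bar>u (- int (Suc n) + 1) - u (- int (Suc n))\<bar> \<le> C * 2 powr (c * - real (Suc n))) sequentially"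
    by (subst (asm) eventually_sequentially_Suc[symmetric])
  then have ev: "eventually (\<lambda>n. norm (X (Suc n) - X n) \<le> C * 2 powr - c * (2 powr - c) ^ n) sequentially"
    by eventually_elim
      (simp add: X_def abs_minus_commute powr_realpow[symmetric] powr_powr powr_add[symmetric] algebra_simps)
  have "summable (\<lambda>n. (2 powr - c) ^ n)"
    using \<open>c > 0\<close> by (intro summable_geometric) (simp add: powr_minus inverse_less_1_iff gr_one_powr)
  then have "summable (\<lambda>n. X (Suc n) - X n)"
    by (intro summable_comparison_test_ev[OF ev] summable_mult)
  then have "convergent (\<lambda>n. \<Sum>i<n. X (Suc i) - X i)"
    by (simp add: summable_iff_convergent)
  then obtain S where S: "(\<lambda>n. X n - X 0) \<longlonglongrightarrow> S"
    by (auto simp: convergent_def sum_lessThan_telescope)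
  then have "X \<longlonglongrightarrow> S + X 0"
    using tendsto_add[OF S tendsto_const[of "X 0"]] by simp
  then show ?thesis
    unfolding filterlim_at_bot_int_iff X_def by blast
qed

lemma geometric_envelope:
  fixes f :: "int \<Rightarrow> real"
  assumes top: "f \<in> O[at_top](\<lambda>n. 2 powr - real_of_int n)"
    and bot: "f \<in> O[at_bot](\<lambda>n. 2 powr real_of_int n)"
  obtains C where "\<And>n. \<bar>f n\<bar> \<le> C * 2 powr - \<bar>real_of_int n\<bar>"
proof -
  define g where "g n = \<bar>f n\<bar> * 2 powr \<bar>real_of_int n\<bar>" for n
  obtain C1 where "C1 > 0" "eventually (\<lambda>n. \<bar>f n\<bar> \<le> C1 * 2 powr - real_of_int n) at_top"
    using top by (auto elim!: landau_o.bigE)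
  then obtain N1 where N1: "\<And>n. n \<ge> N1 \<Longrightarrow> \<bar>f n\<bar> \<le> C1 * 2 powr - real_of_int n"
    by (auto simp: eventually_at_top_linorder)
  obtain C2 where "C2 > 0" "eventually (\<lambda>n. \<bar>f n\<bar> \<le> C2 * 2 powr real_of_int n) at_bot"
    using bot by (auto elim!: landau_o.bigE)
  then obtain N2 where N2: "\<And>n. n \<le> N2 \<Longrightarrow> \<bar>f n\<bar> \<le> C2 * 2 powr real_of_int n"
    by (auto simp: eventually_at_bot_linorder)
  define C where "C = C1 + C2 + (\<Sum>n\<in>{min N2 0..max N1 0}. g n)"
  have nonneg: "(\<Sum>n\<in>{min N2 0..max N1 0}. g n) \<ge> 0"
    by (intro sum_nonneg) (simp add: g_def)
  have "g n \<le> C" for n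
  proof -
    consider "n \<ge> max N1 0" | "n \<le> min N2 0" | "n \<in> {min N2 0..max N1 0}"
      by fastforce
    then show ?thesis
    proof cases
      case 1
      then have "g n \<le> C1"
        using N1[of n] by (simp add: g_def powr_minus field_simps)
      then show ?thesis using nonneg \<open>C2 > 0\<close> by (simp add: C_def)
    next
      case 2
      then have "g n \<le> C2"
        using N2[of n] by (simp add: g_def powr_minus field_simps)
      then show ?thesis using nonneg \<open>C1 > 0\<close> by (simp add: C_def)
    next
      case 3
      then have "g n \<le> (\<Sum>n\<in>{min N2 0..max N1 0}. g n)"
        by (intro member_le_sum) (auto simp: g_def)
      then show ?thesis using \<open>C1 > 0\<close> \<open>C2 > 0\<close> by (simp add: C_def)
    qed
  qed
  then have "\<bar>f n\<bar> \<le> C * 2 powr - \<bar>real_of_int n\<bar>" for n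
    by (simp add: g_def powr_minus field_simps)
  then show ?thesis by (rule that)
qed

lemma summable_on_int_geometric: "(\<lambda>n::int. 2 powr - \<bar>real_of_int n\<bar>) summable_on UNIV"
proof -
  have *: "(\<lambda>n::nat. 2 powr - real n) summable_on UNIV"
  proof (rule norm_summable_imp_summable_on)
    have "summable (\<lambda>n. (1 / 2 :: real) ^ n)"
      by (rule summable_geometric) simp
    then show "summable (\<lambda>n. norm (2 powr - real n))"
      by (simp add: powr_minus powr_realpow power_one_over inverse_eq_divide)
  qed
  have "(\<lambda>n::int. 2 powr - \<bar>real_of_int n\<bar>) summable_on range int"
    using * by (subst summable_on_reindex) (auto simp: o_def)
  moreover have "(\<lambda>n::int. 2 powr - \<bar>real_of_int n\<bar>) summable_on range (\<lambda>n. - int n)"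
    using * by (subst summable_on_reindex) (auto simp: o_def inj_on_def)
  ultimately have "(\<lambda>n::int. 2 powr - \<bar>real_of_int n\<bar>) summable_on range int \<union> (range (\<lambda>n. - int n) - range int)"
    by (intro summable_on_Un_disjoint) (auto intro: summable_on_subset_banach)
  moreover have "range int \<union> (range (\<lambda>n. - int n) - range int) = UNIV"
    by (auto intro: int_cases2)
  ultimately show ?thesis by simp
qed

lemma summable_on_int_if_geometric:
  fixes f :: "int \<Rightarrow> real"
  assumes "f \<in> O[at_top](\<lambda>n. 2 powr - real_of_int n)"
    and "f \<in> O[at_bot](\<lambda>n. 2 powr real_of_int n)"
  shows "f summable_on UNIV"
proof -
  obtain C where C: "\<And>n. \<bar>f n\<bar> \<le> C * 2 powr - \<bar>real_of_int n\<bar>"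
    using geometric_envelope[OF assms] by blast
  have "(\<lambda>n::int. C * 2 powr - \<bar>real_of_int n\<bar>) summable_on UNIV"
    by (rule summable_on_cmult_right[OF summable_on_int_geometric])
  then have "Infinite_Sum.abs_summable_on f UNIV"
    by (rule Infinite_Sum.abs_summable_on_comparison_test') (simp add: C)
  then show ?thesis
    by (rule abs_summable_summable)
qed

section \<open>Quadratic recursions with exponential coefficients\<close>

lemma asymp_equiv_if_ln_diff_tendsto_0:
  fixes f g :: "'a \<Rightarrow> real"
  assumes "((\<lambda>x. ln (f x) - ln (g x)) \<longlongrightarrow> 0) F" and "\<And>x. f x > 0" and "\<And>x. g x > 0"
  shows "f \<sim>[F] g"
proof (rule asymp_equivI')
  have "((\<lambda>x. exp (ln (f x) - ln (g x))) \<longlongrightarrow> exp 0) F"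
    by (intro tendsto_intros assms(1))
  then show "((\<lambda>x. f x / g x) \<longlongrightarrow> 1) F"
    by (simp add: exp_diff assms(2,3))
qed

text \<open>
  The two kernels enter the analysis of the recursion only through the size of \<open>\<zeta>\<close> at both
  ends, measured on the logarithmic scale: \<open>\<zeta> n\<close> is asymptotic to \<open>c_top * 2\<^sup>-\<^sup>\<delta>\<^sup>n\<close> at \<open>\<infinity>\<close>, and
  to \<open>c_bot * 2\<^sup>-\<^sup>n\<close> at \<open>-\<infinity>\<close> with a relative error of order \<open>2\<^sup>q\<^sup>n\<close>. The corresponding pure
  exponential solutions are \<open>2\<^sup>\<delta> / c_top * 2\<^sup>\<delta>\<^sup>n\<close> and \<open>2 / c_bot * 2\<^sup>n\<close>.
\<close>

locale squaring_recursion =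
  fixes \<zeta> :: "int \<Rightarrow> real" and c_top \<delta> c_bot q :: real
  assumes \<zeta>_pos: "\<zeta> n > 0" and c_top_pos: "c_top > 0" and \<delta>_pos: "\<delta> > 0" and c_bot_pos: "c_bot > 0" and q_gt_1: "q > 1"
    and \<zeta>_at_top: "((\<lambda>n. ln (\<zeta> n) - ln (c_top * 2 powr (- \<delta> * n))) \<longlongrightarrow> 0) at_top"
    and \<zeta>_at_bot: "(\<lambda>n. ln (\<zeta> n) - ln (c_bot * 2 powr - real_of_int n)) \<in> O[at_bot](\<lambda>n. 2 powr (q * n))"
begin

definition solution :: "(int \<Rightarrow> real) \<Rightarrow> bool" where
  "solution a \<longleftrightarrow> (\<forall>n. a n > 0 \<and> a (n + 1) = \<zeta> n * (a n)\<^sup>2)"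

lemma solution_pos: "solution a \<Longrightarrow> a n > 0"
  by (simp add: solution_def)

lemma ln_solution_step: "solution a \<Longrightarrow> ln (a (n + 1)) = ln (\<zeta> n) + 2 * ln (a n)"
  using \<zeta>_pos[of n] by (auto simp: solution_def ln_mult ln_realpow less_imp_neq[symmetric])

lemma solution_rescale:
  assumes "solution a"
  shows "solution (\<lambda>n. a n * exp (s * 2 powr n))"
  using assms by (simp add: solution_def powr_add power_mult_distrib exp_double[symmetric] algebra_simps)

lemma solutions_differ_by_rescaling:
  assumes a: "solution a" and b: "solution b"
  obtains s where "\<And>n. b n = a n * exp (s * 2 powr n)"
proof -
  define v where "v n = (ln (b n) - ln (a n)) / 2 powr real_of_int n" for n
  have step: "v (n + 1) = v n" for n
    using ln_solution_step[OF a, of n] ln_solution_step[OF b, of n]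
    by (simp add: v_def powr_add field_simps)
  have "v n = v 0" for n
    by (induction n rule: int_induct[where k = 0]) (use step[of "_ - 1"] in \<open>auto simp: step\<close>)
  then have "ln (b n) - ln (a n) = v 0 * 2 powr n" for n
    by (metis v_def nonzero_divide_eq_eq powr_eq_0_iff zero_neq_numeral)
  then have "b n = a n * exp (v 0 * 2 powr n)" for n
    using exp_ln[OF solution_pos[OF a], of n] exp_ln[OF solution_pos[OF b], of n]
    by (metis add_diff_cancel_left' add_diff_eq exp_add)
  then show ?thesis by (rule that)
qed

text \<open>
  The solution with value \<open>1\<close> at \<open>0\<close>: the increments of \<open>ln (a n) / 2\<^sup>n\<close> are the numbers \<open>f n\<close>
  below, and \<open>S\<close> is their sum from \<open>0\<close> to \<open>n\<close>, with the usual sign for negative \<open>n\<close>.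
\<close>

lemma solution_exists: "\<exists>a. solution a"
proof -
  define f where "f j = ln (\<zeta> j) / 2 powr real_of_int (j + 1)" for j
  define S where "S n = (\<Sum>j\<in>{0..<n}. f j) - (\<Sum>j\<in>{n..<0}. f j)" for n :: int
  have step: "S (n + 1) = S n + f n" for n
  proof (cases "n \<ge> 0")
    case True
    then have "{0..<n + 1} = insert n {0..<n}" "{n..<0} = {}" "{n + 1..<0} = {}" by auto
    then show ?thesis by (simp add: S_def)
  next
    case False
    then have "{n..<0} = insert n {n + 1..<0}" "{0..<n} = {}" "{0..<n + 1} = {}" by auto
    then show ?thesis by (simp add: S_def)
  qed
  have "2 powr real_of_int (n + 1) * S (n + 1) = ln (\<zeta> n) + 2 * (2 powr real_of_int n * S n)" for n
    by (simp add: step f_def distrib_left powr_add)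
  then have "solution (\<lambda>n. exp (2 powr n * S n))"
    using \<zeta>_pos by (simp add: solution_def exp_add exp_double)
  then show ?thesis by blast
qed

lemma solution_at_top:
  assumes "solution a"
  shows "\<exists>L. a \<sim>[at_top] (\<lambda>n. 2 powr \<delta> / c_top * 2 powr (\<delta> * n) * exp (L * 2 powr n))"
proof -
  define T where "T n = 2 powr \<delta> / c_top * 2 powr (\<delta> * n)" for n :: int
  define u where "u n = (ln (a n) - ln (T n)) / 2 powr real_of_int n" for n
  have T_pos: "T n > 0" for n
    using c_top_pos by (simp add: T_def)
  have step: "(u (n + 1) - u n) * 2 powr n = (ln (\<zeta> n) - ln (c_top * 2 powr (- \<delta> * n))) / 2" for n
    using c_top_pos ln_solution_step[OF assms, of n]
    by (simp add: u_def T_def powr_add ln_mult ln_div ln_powr field_simps)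
  have "((\<lambda>n. (u (n + 1) - u n) * 2 powr n) \<longlongrightarrow> 0) at_top"
    unfolding step using tendsto_divide[OF \<zeta>_at_top tendsto_const[of 2]] by simp
  from dyadic_limit_at_top[OF this] obtain L where "((\<lambda>n. (u n - L) * 2 powr n) \<longlongrightarrow> 0) at_top"
    by blast
  moreover have "(u n - L) * 2 powr n = ln (a n) - ln (T n * exp (L * 2 powr n))" for n
    using T_pos[of n] by (simp add: u_def ln_mult field_simps)
  ultimately have "a \<sim>[at_top] (\<lambda>n. T n * exp (L * 2 powr n))"
    using solution_pos[OF assms] T_pos by (intro asymp_equiv_if_ln_diff_tendsto_0) auto
  then show ?thesis by (auto simp: T_def)
qed

text \<open>
  With \<open>B n\<close> the leading term, \<open>a n = B n * exp (u n * 2\<^sup>n)\<close> and \<open>u\<close> converges at \<open>-\<infinity>\<close>; the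
  second term of the expansion is the first-order term of the exponential, since
  \<open>2\<^sup>n \<rightarrow> 0\<close>.
\<close>

lemma solution_at_bot:
  assumes "solution a"
  shows "\<exists>A. (\<lambda>n. a n - 2 / c_bot * (2 powr n + A * 2 powr (2 * real_of_int n)))
               \<in> o[at_bot](\<lambda>n. 2 powr (2 * real_of_int n))"
proof -
  define B where "B n = 2 / c_bot * 2 powr real_of_int n" for n :: int
  define u where "u n = (ln (a n) - ln (B n)) / 2 powr real_of_int n" for n
  have B_pos: "B n > 0" for n
    using c_bot_pos by (simp add: B_def)
  have step: "u (n + 1) - u n = (ln (\<zeta> n) - ln (c_bot * 2 powr - real_of_int n)) * (1 / 2 * 2 powr - real_of_int n)" for n
    using c_bot_pos ln_solution_step[OF assms, of n] ln_realpow[of 2 2]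
    by (simp add: u_def B_def powr_add powr_minus ln_mult ln_div ln_powr field_simps)
  have "(\<lambda>n. (ln (\<zeta> n) - ln (c_bot * 2 powr - real_of_int n)) * (1 / 2 * 2 powr - real_of_int n))
      \<in> O[at_bot](\<lambda>n. 2 powr (q * n) * 2 powr - real_of_int n)"
    by (intro landau_o.big.mult \<zeta>_at_bot) simp
  moreover have "2 powr (q * n) * 2 powr - n = 2 powr ((q - 1) * n)" for n :: real
    by (simp add: powr_add[symmetric] algebra_simps)
  ultimately have "(\<lambda>n. u (n + 1) - u n) \<in> O[at_bot](\<lambda>n. 2 powr ((q - 1) * n))"
    by (simp only: step)
  from geometric_increments_converge_at_bot[OF this] q_gt_1 obtain A where A: "(u \<longlongrightarrow> A) at_bot"
    by auto
  have a_eq: "a n = B n * exp (u n * 2 powr n)" for n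
    using B_pos[of n] solution_pos[OF assms, of n] by (simp add: u_def exp_diff)
  \<comment> \<open>The difference quotient of \<open>exp\<close> at \<open>0\<close>, continuously extended, so that \<open>u n = 0\<close> needs no special case.\<close>
  obtain g :: "real \<Rightarrow> real" where g: "\<And>y. exp y - 1 = g y * y" "isCont g 0" "g 0 = 1"
    using DERIV_exp[of "0::real"] unfolding CARAT_DERIV by auto
  have "((\<lambda>n. u n * 2 powr n) \<longlongrightarrow> A * 0) at_bot"
    by (intro tendsto_mult A) real_asymp
  then have "((\<lambda>n. g (u n * 2 powr n)) \<longlongrightarrow> 1) at_bot"
    using isCont_tendsto_compose[OF g(2), of "\<lambda>n. u n * 2 powr n" at_bot] g(3) by simp
  then have "((\<lambda>n. 2 / c_bot * (g (u n * 2 powr n) * u n - A)) \<longlongrightarrow> 2 / c_bot * (1 * A - A)) at_bot"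
    by (intro tendsto_intros A)
  moreover have "2 / c_bot * (g (u n * 2 powr n) * u n - A) =
      (a n - 2 / c_bot * (2 powr n + A * 2 powr (2 * real_of_int n))) / 2 powr (2 * real_of_int n)" for n
  proof -
    define w :: real where "w = 2 powr real_of_int n"
    have "w > 0" by (simp add: w_def)
    have w2: "2 powr (2 * real_of_int n) = w\<^sup>2"
      by (simp add: w_def power2_eq_square powr_add[symmetric])
    have "a n = 2 / c_bot * w * (1 + g (u n * w) * (u n * w))"
      using a_eq[of n] g(1)[of "u n * w"] by (simp add: B_def w_def)
    then show ?thesis
      unfolding w2 w_def[symmetric] using \<open>w > 0\<close> c_bot_pos by (simp add: field_simps power2_eq_square)
  qed
  ultimately have "(\<lambda>n. a n - 2 / c_bot * (2 powr n + A * 2 powr (2 * real_of_int n)))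
               \<in> o[at_bot](\<lambda>n. 2 powr (2 * real_of_int n))"
    by (intro smalloI_tendsto) auto
  then show ?thesis by blast
qed

lemma solution_bigo_at_bot:
  assumes "solution a"
  shows "a \<in> O[at_bot](\<lambda>n. 2 powr real_of_int n)"
proof -
  obtain A where A: "(\<lambda>n. a n - 2 / c_bot * (2 powr n + A * 2 powr (2 * real_of_int n)))
               \<in> o[at_bot](\<lambda>n. 2 powr (2 * real_of_int n))"
    using solution_at_bot[OF assms] by blast
  have square: "(\<lambda>n. 2 powr (2 * real_of_int n)) \<in> O[at_bot](\<lambda>n. 2 powr real_of_int n)"
    by real_asymp
  have "(\<lambda>n. a n - 2 / c_bot * (2 powr n + A * 2 powr (2 * real_of_int n)))
               \<in> O[at_bot](\<lambda>n. 2 powr real_of_int n)"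
    using landau_o.big_trans[OF landau_o.small_imp_big[OF A] square] .
  moreover have "(\<lambda>n. 2 / c_bot * (2 powr n + A * 2 powr (2 * real_of_int n))) \<in> O[at_bot](\<lambda>n. 2 powr real_of_int n)"
  proof -
    have "(\<lambda>n. A * 2 powr (2 * real_of_int n)) \<in> O[at_bot](\<lambda>n. 2 powr real_of_int n)"
      using square by (cases "A = 0") auto
    then show ?thesis
      using c_bot_pos by (subst landau_o.big.cmult_in_iff) (auto intro!: sum_in_bigo)
  qed
  ultimately show ?thesis
    using sum_in_bigo(1) by fastforce
qed

lemma solution_bigo_at_top:
  assumes "a \<sim>[at_top] (\<lambda>n::int. 2 powr \<delta> / c_top * 2 powr (\<delta> * n) * exp (- A * 2 powr n))" and "A > 0"
  shows "a \<in> O[at_top](\<lambda>n. 2 powr (- e * real_of_int n))"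
proof -
  have "(\<lambda>n::int. 2 powr \<delta> / c_top * 2 powr (\<delta> * n) * exp (- A * 2 powr n)) \<in> O[at_top](\<lambda>n. 2 powr (- e * real_of_int n))"
    using \<open>A > 0\<close> c_top_pos \<delta>_pos by real_asymp
  then show ?thesis
    using asymp_equiv_imp_bigo[OF assms(1)] landau_o.big_trans by blast
qed

text \<open>
  If \<open>L \<ge> 0\<close> the solution would be at least of the order of \<open>2\<^sup>\<delta>\<^sup>n\<close>, which is unbounded as
  \<open>\<delta> > 0\<close>.
\<close>

lemma solution_at_top_decay:
  assumes "solution a" and "bounded (range a)"
  shows "\<exists>A>0. a \<sim>[at_top] (\<lambda>n. 2 powr \<delta> / c_top * 2 powr (\<delta> * n) * exp (- A * 2 powr n))"
proof -
  obtain L where L: "a \<sim>[at_top] (\<lambda>n. 2 powr \<delta> / c_top * 2 powr (\<delta> * n) * exp (L * 2 powr n))"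
    using solution_at_top[OF assms(1)] by blast
  have "L < 0"
  proof (rule ccontr)
    assume "\<not> L < 0"
    have "filterlim (\<lambda>n::int. 2 powr \<delta> / c_top * 2 powr (\<delta> * n)) at_top at_top"
      using c_top_pos \<delta>_pos by real_asymp
    then have "filterlim (\<lambda>n::int. 2 powr \<delta> / c_top * 2 powr (\<delta> * n) * exp (L * 2 powr n)) at_top at_top"
    proof (rule filterlim_at_top_mono, intro always_eventually allI)
      fix n :: int
      have "L * 2 powr n \<ge> 0" using \<open>\<not> L < 0\<close> by simp
      then have "2 powr \<delta> / c_top * 2 powr (\<delta> * n) * 1 \<le> 2 powr \<delta> / c_top * 2 powr (\<delta> * n) * exp (L * 2 powr n)"
        using c_top_pos by (intro mult_left_mono) auto
      then show "2 powr \<delta> / c_top * 2 powr (\<delta> * n) \<le> 2 powr \<delta> / c_top * 2 powr (\<delta> * n) * exp (L * 2 powr n)"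
        by simp
    qed
    then have "filterlim a at_top at_top"
      using asymp_equiv_at_top_transfer[OF asymp_equiv_symI[OF L]] by blast
    moreover obtain C where "\<And>n. \<bar>a n\<bar> \<le> C"
      using assms(2) by (auto simp: bounded_iff)
    ultimately show False
      by (metis abs_ge_self eventually_at_top_linorder filterlim_at_top_dense less_le_not_le order.trans order_refl)
  qed
  then show ?thesis
    using L by (intro exI[of _ "- L"]) simp
qed

text \<open>
  The bounded solutions form the one-parameter family \<open>p n * exp (s * 2\<^sup>n)\<close>, \<open>s < 0\<close>, with \<open>p\<close>
  normalised to have no exponential factor at \<open>\<infinity>\<close>. The parameter of mass \<open>m\<close> is found by the
  intermediate value theorem; it is unique because every term of the mass increases
  strictly with \<open>s\<close>.
\<close>

lemma unique_bounded_solution_of_given_mass: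
  assumes "m > 0"
  shows "\<exists>!a. solution a \<and> bounded (range a) \<and> ((\<lambda>n. 2 powr real_of_int n * a n) has_sum m) UNIV"
proof (rule ex_ex1I)
  obtain a L where "solution a" and L: "a \<sim>[at_top] (\<lambda>n. 2 powr \<delta> / c_top * 2 powr (\<delta> * n) * exp (L * 2 powr n))"
    using solution_exists solution_at_top by blast
  define p where "p n = a n * exp (- L * 2 powr n)" for n :: int
  have p: "solution p"
    unfolding p_def using solution_rescale[OF \<open>solution a\<close>] .
  note p_pos = solution_pos[OF p]
  have scaled: "(\<lambda>n. p n * exp (s * 2 powr n)) \<sim>[at_top]
      (\<lambda>n. 2 powr \<delta> / c_top * 2 powr (\<delta> * n) * exp (s * 2 powr n))" for s
  proof -
    have "(\<lambda>n. a n * exp ((s - L) * 2 powr n)) \<sim>[at_top]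
      (\<lambda>n. 2 powr \<delta> / c_top * 2 powr (\<delta> * n) * exp (L * 2 powr n) * exp ((s - L) * 2 powr n))"
      by (intro asymp_equiv_intros L)
    then show ?thesis
      by (simp add: p_def mult.assoc exp_add[symmetric] algebra_simps)
  qed
  have top: "(\<lambda>n. p n * exp (s * 2 powr n)) \<in> O[at_top](\<lambda>n. 2 powr (- e * real_of_int n))" if "s < 0" for s e
    using solution_bigo_at_top[of "\<lambda>n. p n * exp (s * 2 powr n)" "- s" e] scaled[of s] that by simp
  have bot: "(\<lambda>n. p n * exp (s * 2 powr n)) \<in> O[at_bot](\<lambda>n. 2 powr real_of_int n)" for s
    by (rule solution_bigo_at_bot[OF solution_rescale[OF p]])
  have summable: "(\<lambda>n. 2 powr n * (p n * exp (s * 2 powr n))) summable_on UNIV" if "s < 0" for s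
  proof (rule summable_on_int_if_geometric)
    have "(\<lambda>n::int. 2 powr n * (p n * exp (s * 2 powr n))) \<in> O[at_top](\<lambda>n. 2 powr n * 2 powr (- 2 * real_of_int n))"
      by (intro landau_o.big.mult top that) simp
    then show "(\<lambda>n::int. 2 powr n * (p n * exp (s * 2 powr n))) \<in> O[at_top](\<lambda>n. 2 powr - real_of_int n)"
      by (simp add: powr_add[symmetric])
    have "(\<lambda>n. 2 powr real_of_int n) \<in> O[at_bot](\<lambda>_. 1)"
      by real_asymp
    from landau_o.big.mult[OF this bot]
    show "(\<lambda>n::int. 2 powr n * (p n * exp (s * 2 powr n))) \<in> O[at_bot](\<lambda>n. 2 powr real_of_int n)"
      by simp
  qed
  have summable0: "(\<lambda>n. p n * exp (s * 2 powr n)) summable_on UNIV" if "s < 0" for s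
    using top[OF that, of 1] bot[of s] by (intro summable_on_int_if_geometric) auto
  define F where "F s = (\<Sum>\<^sub>\<infinity>n. 2 powr real_of_int n * (p n * exp (s * 2 powr n)))" for s
  have has_sum_F: "((\<lambda>n. 2 powr real_of_int n * (p n * exp (s * 2 powr n))) has_sum F s) UNIV" if "s < 0" for s
    unfolding F_def using summable[OF that] by (rule has_sum_infsum)
  obtain s2 where "s2 < 0" "F s2 \<ge> m"
  proof -
    have "filterlim (\<lambda>n::int. 2 powr \<delta> / c_top * 2 powr (\<delta> * n)) at_top at_top"
      using c_top_pos \<delta>_pos by real_asymp
    then have "filterlim p at_top at_top"
      using asymp_equiv_at_top_transfer[OF asymp_equiv_symI[OF scaled[of 0]]] by simp
    then have "eventually (\<lambda>n. p n \<ge> m * exp 1 \<and> n \<ge> 0) at_top"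
      by (intro eventually_conj eventually_ge_at_top) (simp add: filterlim_at_top)
    then obtain n where n: "p n \<ge> m * exp 1" "n \<ge> 0"
      using eventually_happens'[OF trivial_limit_at_top_linorder] by blast
    \<comment> \<open>For this parameter the exponential factor at the index \<open>n\<close> is \<open>1 / e\<close>; the single term there is already at least \<open>m\<close>.\<close>
    define s where "s = - (2 powr - real_of_int n)"
    have "s < 0" by (simp add: s_def)
    have s: "s * 2 powr n = -1"
      by (simp add: s_def powr_minus)
    have "m \<le> p n * exp (-1)"
      using n(1) by (simp add: exp_minus field_simps)
    also have "\<dots> \<le> 2 powr real_of_int n * (p n * exp (-1))"
      using mult_right_mono[of 1 "2 powr real_of_int n" "p n * exp (-1)"] n(2) p_pos[of n]
      by (simp add: ge_one_powr_ge_zero)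
    also have "\<dots> = (\<Sum>n\<in>{n}. 2 powr real_of_int n * (p n * exp (s * 2 powr n)))"
      by (simp add: s)
    also have "\<dots> \<le> F s"
      unfolding F_def using p_pos summable[OF \<open>s < 0\<close>]
      by (intro finite_sum_le_infsum) (auto intro: less_imp_le)
    finally show ?thesis using that \<open>s < 0\<close> by blast
  qed
  obtain s1 where "s1 \<le> s2" "F s1 \<le> m"
  proof -
    \<comment> \<open>From \<open>w * exp (- c * w) \<le> 1 / c\<close> with \<open>w = 2\<^sup>n\<close>, the mass for the parameter \<open>- 1 - c\<close> is at
      most \<open>C / c\<close>. The extra \<open>1\<close> in the choice of \<open>s\<close> makes \<open>c\<close> positive.\<close>
    define C where "C = (\<Sum>\<^sub>\<infinity>n. p n * exp (- 1 * 2 powr real_of_int n))"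
    have "C \<ge> 0"
      unfolding C_def by (intro infsum_nonneg) (use p_pos in \<open>auto intro: less_imp_le\<close>)
    define s where "s = min s2 (- 1 - (C + 1) / m)"
    define c where "c = - s - 1"
    have "c \<ge> (C + 1) / m" by (simp add: c_def s_def)
    moreover have "(C + 1) / m > 0" using \<open>C \<ge> 0\<close> \<open>m > 0\<close> by simp
    ultimately have "c > 0" by linarith
    have "s < 0" using \<open>c > 0\<close> by (simp add: c_def)
    have le: "2 powr real_of_int n * (p n * exp (s * 2 powr n)) \<le> 1 / c * (p n * exp (- 1 * 2 powr real_of_int n))" for n
    proof -
      define w where "w = 2 powr real_of_int n"
      have "c * w \<le> exp (c * w)"
        using exp_ge_add_one_self[of "c * w"] by linarith
      then have "c * w * exp (- (c * w)) \<le> 1"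
        by (simp add: exp_minus field_simps)
      then have "w * exp (- (c * w)) \<le> 1 / c"
        using \<open>c > 0\<close> by (simp add: field_simps)
      then have "w * exp (- (c * w)) * (p n * exp (- 1 * w)) \<le> 1 / c * (p n * exp (- 1 * w))"
        using p_pos[of n] by (intro mult_right_mono) auto
      moreover have "exp (s * w) = exp (- (c * w)) * exp (- 1 * w)"
        by (simp add: c_def exp_add[symmetric] algebra_simps)
      ultimately show ?thesis
        unfolding w_def[symmetric] by (simp add: mult_ac)
    qed
    have "F s \<le> (\<Sum>\<^sub>\<infinity>n. 1 / c * (p n * exp (- 1 * 2 powr real_of_int n)))"
      unfolding F_def using summable[OF \<open>s < 0\<close>] summable_on_cmult_right[OF summable0[of "-1"], of "1 / c"] le
      by (intro infsum_mono) auto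
    also have "\<dots> = C / c"
      using summable0[of "-1"] by (subst infsum_cmult_right) (auto simp: C_def)
    also have "\<dots> \<le> m"
      using \<open>c > 0\<close> \<open>c \<ge> (C + 1) / m\<close> \<open>m > 0\<close> by (simp add: field_simps)
    finally show ?thesis using that[of s] by (simp add: s_def)
  qed
  have "continuous_on {s1..s2} F"
  proof (rule uniform_limit_theorem[OF always_eventually])
    show "uniform_limit {s1..s2} (\<lambda>X s. \<Sum>n\<in>X. 2 powr real_of_int n * (p n * exp (s * 2 powr n))) F (finite_subsets_at_top UNIV)"
      unfolding F_def
    proof (rule Weierstrass_m_test_general[OF _ summable[OF \<open>s2 < 0\<close>]])
      fix n :: int and s assume "s \<in> {s1..s2}"
      then show "norm (2 powr real_of_int n * (p n * exp (s * 2 powr n))) \<le> 2 powr real_of_int n * (p n * exp (s2 * 2 powr n))"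
        using p_pos[of n] by (auto simp: abs_mult intro!: mult_left_mono)
    qed
  qed (auto intro!: continuous_intros)
  then obtain s where s: "s \<le> s2" "F s = m"
    using IVT'[of F s1 m s2] \<open>F s1 \<le> m\<close> \<open>m \<le> F s2\<close> \<open>s1 \<le> s2\<close> by blast
  then have "s < 0" using \<open>s2 < 0\<close> by simp
  define b where "b n = p n * exp (s * 2 powr real_of_int n)" for n
  have "solution b" unfolding b_def by (rule solution_rescale[OF p])
  moreover have "bounded (range b)"
  proof -
    obtain C where C: "\<And>n. \<bar>b n\<bar> \<le> C * 2 powr - \<bar>real_of_int n\<bar>"
      using geometric_envelope[of b] top[OF \<open>s < 0\<close>, of 1] bot[of s] unfolding b_def by auto
    have "C \<ge> 0" using C[of 0] by simp
    have "\<bar>b n\<bar> \<le> C" for n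
      using C[of n] mult_left_mono[of "2 powr - \<bar>real_of_int n\<bar>" 1 C] \<open>C \<ge> 0\<close> powr_mono[of "- \<bar>real_of_int n\<bar>" 0 2] by simp
    then show ?thesis by (auto simp: bounded_iff)
  qed
  moreover have "((\<lambda>n. 2 powr real_of_int n * b n) has_sum m) UNIV"
    using has_sum_F[OF \<open>s < 0\<close>] s(2) by (simp add: b_def)
  ultimately show "\<exists>a. solution a \<and> bounded (range a) \<and> ((\<lambda>n. 2 powr real_of_int n * a n) has_sum m) UNIV"
    by blast
next
  fix a b
  assume "solution a \<and> bounded (range a) \<and> ((\<lambda>n. 2 powr real_of_int n * a n) has_sum m) UNIV"
    and "solution b \<and> bounded (range b) \<and> ((\<lambda>n. 2 powr real_of_int n * b n) has_sum m) UNIV"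
  then have a: "solution a" "((\<lambda>n. 2 powr real_of_int n * a n) has_sum m) UNIV"
    and b: "solution b" "((\<lambda>n. 2 powr real_of_int n * b n) has_sum m) UNIV" by auto
  obtain s where s: "\<And>n. b n = a n * exp (s * 2 powr n)"
    using solutions_differ_by_rescaling[OF a(1) b(1)] by blast
  note a_pos = solution_pos[OF a(1)]
  consider "s < 0" | "s = 0" | "s > 0" by linarith
  then show "a = b"
  proof cases
    case 1
    then have "2 powr real_of_int n * b n < 2 powr real_of_int n * a n" for n
      using a_pos[of n] by (simp add: s mult_neg_pos)
    then have "m < m"
      by (intro has_sum_strict_mono[OF b(2) a(2), of 0]) (auto intro: less_imp_le)
    then show ?thesis by simp
  next
    case 2
    then show ?thesis by (simp add: s fun_eq_iff)
  next
    case 3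
    then have "2 powr real_of_int n * a n < 2 powr real_of_int n * b n" for n
      using a_pos[of n] by (simp add: s)
    then have "m < m"
      by (intro has_sum_strict_mono[OF a(2) b(2), of 0]) (auto intro: less_imp_le)
    then show ?thesis by simp
  qed
qed

end

section \<open>Integration against Dirac combs and stationarity\<close>

text \<open>
  Unconditional and absolute summability agree for real families, so sums over the lattice can be
  computed as Lebesgue integrals for the counting measure and conversely.
\<close>

lemma summable_on_real_iff_integrable:
  fixes f :: "'a \<Rightarrow> real"
  shows "f summable_on A \<longleftrightarrow> integrable (count_space A) f"
  unfolding abs_summable_on_def[symmetric] abs_summable_equivalent[symmetric]
  by (rule summable_on_iff_abs_summable_on_real)

lemma sets_dirac_comb [simp, measurable_cong]: "sets (dirac_comb \<rho> a) = sets borel"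
  and space_dirac_comb [simp]: "space (dirac_comb \<rho> a) = UNIV"
  by (simp_all add: dirac_comb_def)

lemma
  fixes f :: "real \<Rightarrow> real"
  assumes [measurable]: "f \<in> borel_measurable borel" and a: "\<And>n. a n \<ge> 0"
  shows integrable_dirac_comb_iff:
      "integrable (dirac_comb \<rho> a) f \<longleftrightarrow> (\<lambda>n. a n * f (of_int n + \<rho>)) summable_on UNIV"
    and integral_dirac_comb:
      "(LINT x|dirac_comb \<rho> a. f x) = (\<Sum>\<^sub>\<infinity>n. a n * f (of_int n + \<rho>))"
proof -
  have "integrable (dirac_comb \<rho> a) f \<longleftrightarrow>
      integrable (density (count_space UNIV) (\<lambda>n. ennreal (a n))) (\<lambda>n. f (of_int n + \<rho>))"
    unfolding dirac_comb_def by (subst integrable_distr_eq) auto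
  also have "\<dots> \<longleftrightarrow> integrable (count_space UNIV) (\<lambda>n. a n * f (of_int n + \<rho>))"
    by (subst integrable_density) (auto simp: a)
  also have "\<dots> \<longleftrightarrow> (\<lambda>n. a n * f (of_int n + \<rho>)) summable_on UNIV"
    by (rule summable_on_real_iff_integrable[symmetric])
  finally show *: "integrable (dirac_comb \<rho> a) f \<longleftrightarrow> (\<lambda>n. a n * f (of_int n + \<rho>)) summable_on UNIV" .
  show "(LINT x|dirac_comb \<rho> a. f x) = (\<Sum>\<^sub>\<infinity>n. a n * f (of_int n + \<rho>))"
  proof (cases "(\<lambda>n. a n * f (of_int n + \<rho>)) summable_on UNIV")
    case True
    have "(LINT x|dirac_comb \<rho> a. f x) =
        (LINT n|density (count_space UNIV) (\<lambda>n. ennreal (a n)). f (of_int n + \<rho>))"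
      unfolding dirac_comb_def by (subst integral_distr) auto
    also have "\<dots> = (LINT n|count_space UNIV. a n * f (of_int n + \<rho>))"
      by (subst integral_density) (auto simp: a)
    also have "\<dots> = (\<Sum>\<^sub>\<infinity>n. a n * f (of_int n + \<rho>))"
      using True
      by (subst infsetsum_infsum[symmetric])
        (simp_all add: summable_on_real_iff_integrable abs_summable_on_def infsetsum_def)
    finally show ?thesis .
  next
    case False
    then show ?thesis
      using * by (simp add: not_integrable_integral_eq infsum_not_exists)
  qed
qed

lemma finite_measure_dirac_comb:
  assumes "\<And>n. a n \<ge> 0" "a summable_on UNIV"
  shows "finite_measure (dirac_comb \<rho> a)"
proof -
  have "integrable (dirac_comb \<rho> a) (\<lambda>_. 1 :: real)"
    using assms by (subst integrable_dirac_comb_iff) auto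
  then show ?thesis
    by (intro finite_measureI) (auto simp: integrable_iff_bounded)
qed

lemma
  fixes f :: "real \<Rightarrow> real"
  assumes "f \<in> borel_measurable borel" "\<And>n. a n \<ge> 0" "\<And>m. m \<noteq> n \<Longrightarrow> f (of_int m + \<rho>) = 0"
  shows integrable_dirac_comb_single: "integrable (dirac_comb \<rho> a) f"
    and integral_dirac_comb_single: "(LINT x|dirac_comb \<rho> a. f x) = a n * f (of_int n + \<rho>)"
proof -
  have "((\<lambda>m. a m * f (of_int m + \<rho>)) has_sum (\<Sum>m\<in>{n}. a m * f (of_int m + \<rho>))) UNIV"
    using assms(3) by (intro has_sum_finite_neutralI[of "{n}"]) auto
  then show "integrable (dirac_comb \<rho> a) f"
    and "(LINT x|dirac_comb \<rho> a. f x) = a n * f (of_int n + \<rho>)"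
    using assms(1,2)
    by (auto simp: integrable_dirac_comb_iff integral_dirac_comb summable_on_def dest: infsumI)
qed

text \<open>
  Fubini: for each lattice point the inner integral has a single nonzero term, and the outer
  integral sums these. Absolute summability along the diagonal is what integrability on
  the plane requires.
\<close>

lemma
  fixes f :: "real \<times> real \<Rightarrow> real"
  assumes f: "f \<in> borel_measurable borel" and a: "\<And>n. a n \<ge> 0" "a summable_on UNIV"
    and off_diagonal: "\<And>n m. n \<noteq> m \<Longrightarrow> f (of_int n + \<rho>, of_int m + \<rho>) = 0"
    and diagonal: "(\<lambda>n. (a n)\<^sup>2 * f (of_int n + \<rho>, of_int n + \<rho>)) summable_on UNIV"
  shows integrable_dirac_comb_pair_diagonal: "integrable (dirac_comb \<rho> a \<Otimes>\<^sub>M dirac_comb \<rho> a) f"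
    and integral_dirac_comb_pair_diagonal:
      "(LINT p|(dirac_comb \<rho> a \<Otimes>\<^sub>M dirac_comb \<rho> a). f p) =
        (\<Sum>\<^sub>\<infinity>n. (a n)\<^sup>2 * f (of_int n + \<rho>, of_int n + \<rho>))"
proof -
  let ?g = "dirac_comb \<rho> a"
  interpret finite_measure ?g
    using a by (rule finite_measure_dirac_comb)
  interpret P: pair_sigma_finite ?g ?g ..
  have [measurable]: "f \<in> borel_measurable (borel \<Otimes>\<^sub>M borel)"
    using f by (simp add: borel_prod)
  have [measurable]: "f \<in> borel_measurable (?g \<Otimes>\<^sub>M ?g)"
    by measurable
  have inner: "integrable ?g (\<lambda>y. f (of_int n + \<rho>, y))"
    "(LINT y|?g. f (of_int n + \<rho>, y)) = a n * f (of_int n + \<rho>, of_int n + \<rho>)"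
    "(LINT y|?g. \<bar>f (of_int n + \<rho>, y)\<bar>) = a n * \<bar>f (of_int n + \<rho>, of_int n + \<rho>)\<bar>" for n
    using off_diagonal[of n] a(1)
    by (auto intro!: integrable_dirac_comb_single[of _ _ n]
        simp: integral_dirac_comb_single[of _ _ n])
  have [measurable]: "(\<lambda>x. LINT y|?g. norm (f (x, y))) \<in> borel_measurable borel"
    "(\<lambda>x. LINT y|?g. f (x, y)) \<in> borel_measurable borel"
    by measurable
  have "(\<lambda>n. \<bar>(a n)\<^sup>2 * f (of_int n + \<rho>, of_int n + \<rho>)\<bar>) summable_on UNIV"
    using diagonal summable_on_iff_abs_summable_on_real by fastforce
  then have "integrable ?g (\<lambda>x. LINT y|?g. norm (f (x, y)))"
    using a(1) by (subst integrable_dirac_comb_iff)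
      (simp_all add: inner abs_mult power2_eq_square mult.assoc)
  moreover have "AE x in ?g. integrable ?g (\<lambda>y. f (x, y))"
    \<comment> \<open>Only the measure of the outer quantifier is unfolded; the inner one must stay folded for \<open>inner\<close>.\<close>
    unfolding dirac_comb_def[of \<rho> a, THEN arg_cong[of _ _ ae_filter]]
    by (subst AE_distr_iff) (simp_all add: inner)
  ultimately show *: "integrable (?g \<Otimes>\<^sub>M ?g) f"
    by (intro P.Fubini_integrable) auto
  have "(LINT p|(?g \<Otimes>\<^sub>M ?g). f p) = (LINT x|?g. LINT y|?g. f (x, y))"
    using P.integral_fst'[OF *] by simp
  also have "\<dots> = (\<Sum>\<^sub>\<infinity>n. (a n)\<^sup>2 * f (of_int n + \<rho>, of_int n + \<rho>))"
    using a(1) by (subst integral_dirac_comb) (simp_all add: inner power2_eq_square mult.assoc)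
  finally show "(LINT p|(?g \<Otimes>\<^sub>M ?g). f p) = (\<Sum>\<^sub>\<infinity>n. (a n)\<^sup>2 * f (of_int n + \<rho>, of_int n + \<rho>))" .
qed

lemma coag_integrand_measurable:
  assumes "continuous_on {0..} k" "continuous_on UNIV Q" "continuous_on UNIV \<phi>"
  shows "coag_integrand k Q \<phi> \<in> borel_measurable borel"
proof (rule borel_measurable_continuous_onI)
  note [continuous_intros] = continuous_on_compose2[OF assms(1)]
    continuous_on_compose2[OF assms(2)] continuous_on_compose2[OF assms(3)]
  have nz: "2 powr x + 2 powr y \<noteq> 0" for x y :: real
    by (simp add: add_pos_pos less_imp_neq[symmetric])
  show "continuous_on UNIV (coag_integrand k Q \<phi>)"
    unfolding coag_integrand_def coag_kernel_def case_prod_unfold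
    by (intro continuous_intros) (auto simp: nz)
qed

lemma frag_integrand_measurable:
  assumes "continuous_on {0<..} \<gamma>" "continuous_on UNIV \<phi>"
  shows "frag_integrand \<gamma> \<phi> \<in> borel_measurable borel"
proof (rule borel_measurable_continuous_onI)
  note [continuous_intros] = continuous_on_compose2[OF assms(1)] continuous_on_compose2[OF assms(2)]
  show "continuous_on UNIV (frag_integrand \<gamma> \<phi>)"
    unfolding frag_integrand_def by (intro continuous_intros) auto
qed

lemma coag_integrand_diagonal:
  "coag_integrand k Q \<phi> (x, x) = k (2 powr x) * Q 0 / (2 * 2 powr x) * (\<phi> (x + 1) - 2 * \<phi> x)"
proof -
  have "ln (2 powr x + 2 powr x) / ln 2 = x + 1"
  proof -
    have "2 powr x + 2 powr x = 2 powr (x + 1)" by (simp add: powr_add)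
    then show ?thesis by (simp only: ln_powr) simp
  qed
  moreover have "2 * 2 powr x / (2 powr x + 2 powr x) - 1 = (0::real)" by simp
  ultimately show ?thesis
    unfolding coag_integrand_def coag_kernel_def by simp
qed

text \<open>
  Different lattice points give sizes \<open>x\<close>, \<open>y\<close> differing at least by a factor of \<open>2\<close>, and then
  \<open>\<bar>y - x\<bar> / (x + y) \<ge> 1 / 3\<close>, which lies outside the support of \<open>Q\<close>.
\<close>

lemma coag_integrand_off_diagonal:
  fixes n m :: int
  assumes supp: "closure {x. Q x \<noteq> 0} \<subseteq> {-1/3<..<1/3}" and "n \<noteq> m"
  shows "coag_integrand k Q \<phi> (of_int n + \<rho>, of_int m + \<rho>) = 0"
proof -
  define x y where "x = 2 powr (of_int n + \<rho>)" and "y = 2 powr (of_int m + \<rho>)"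
  have pos: "x > 0" "y > 0" by (simp_all add: x_def y_def)
  have gap: "2 * 2 powr (of_int i + \<rho>) \<le> 2 powr (of_int j + \<rho>)" if "i < j" for i j :: int
  proof -
    have "2 powr (of_int i + \<rho> + 1) \<le> 2 powr (of_int j + \<rho>)"
      using that by (intro powr_mono) auto
    then show ?thesis by (simp add: powr_add)
  qed
  from \<open>n \<noteq> m\<close> consider "2 * x \<le> y" | "2 * y \<le> x"
    using gap[of n m] gap[of m n] by (auto simp: x_def y_def neq_iff)
  then have "2 * y / (x + y) - 1 \<notin> {-1/3<..<1/3}"
    by cases (use pos in \<open>auto simp: field_simps\<close>)
  then have "Q (2 * y / (x + y) - 1) = 0"
    using supp closure_subset[of "{x. Q x \<noteq> 0}"] by blast
  then show ?thesis
    by (simp add: coag_integrand_def coag_kernel_def x_def y_def)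
qed

lemma test_function_frag_bounds:
  assumes "test_function \<phi>"
    and "(\<lambda>x. \<gamma> (2 powr x)) \<in> O[at_bot](\<lambda>_. 1)"
    and "(\<lambda>x. \<gamma> (2 powr x)) \<in> O[at_top](\<lambda>x. 2 powr (\<beta> * x))"
  shows "frag_integrand \<gamma> \<phi> \<in> O[at_bot](\<lambda>_. 1)"
    and "frag_integrand \<gamma> \<phi> \<in> O[at_top](\<lambda>x. 2 powr ((\<beta> + 1) * x))"
proof -
  obtain l where l: "(\<phi> \<longlongrightarrow> l) at_bot" and top: "\<phi> \<in> O[at_top](\<lambda>x. 2 powr x)"
    using assms(1) by (auto simp: test_function_def)
  have bot: "\<phi> \<in> O[at_bot](\<lambda>_. 1)"
    using l by (intro bigoI_tendsto[of _ _ l]) auto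
  have "filterlim (\<lambda>x::real. x - 1) at_bot at_bot" "filterlim (\<lambda>x::real. x - 1) at_top at_top"
    by real_asymp+
  then have shift: "(\<lambda>x. \<phi> (x - 1)) \<in> O[at_bot](\<lambda>_. 1)" "(\<lambda>x. \<phi> (x - 1)) \<in> O[at_top](\<lambda>x. 2 powr (x - 1))"
    using landau_o.big.compose[OF bot] landau_o.big.compose[OF top] by blast+
  have "(\<lambda>x. 2 powr (x - 1)) \<in> O[at_top](\<lambda>x. 2 powr x :: real)"
    by real_asymp
  then have shift_top: "(\<lambda>x. \<phi> (x - 1)) \<in> O[at_top](\<lambda>x. 2 powr x)"
    using shift(2) landau_o.big_trans by blast
  have "(\<lambda>x. \<gamma> (2 powr x) * (\<phi> x - 2 * \<phi> (x - 1))) \<in> O[at_bot](\<lambda>_. 1 * 1)"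
    by (intro landau_o.big.mult assms(2) sum_in_bigo bot) (simp add: shift)
  then show "frag_integrand \<gamma> \<phi> \<in> O[at_bot](\<lambda>_. 1)"
    by (simp add: frag_integrand_def[abs_def])
  have "(\<lambda>x. \<gamma> (2 powr x) * (\<phi> x - 2 * \<phi> (x - 1))) \<in> O[at_top](\<lambda>x. 2 powr (\<beta> * x) * 2 powr x)"
    by (intro landau_o.big.mult assms(3) sum_in_bigo top) (simp add: shift_top)
  then show "frag_integrand \<gamma> \<phi> \<in> O[at_top](\<lambda>x. 2 powr ((\<beta> + 1) * x))"
    by (simp add: frag_integrand_def[abs_def] powr_add[symmetric] algebra_simps)
qed

lemma summable_against_decaying_coefficients:
  fixes a :: "int \<Rightarrow> real" and f :: "real \<Rightarrow> real"
  assumes a_top: "\<And>e. a \<in> O[at_top](\<lambda>n. 2 powr (- e * real_of_int n))"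
    and a_bot: "a \<in> O[at_bot](\<lambda>n. 2 powr real_of_int n)"
    and f_top: "f \<in> O[at_top](\<lambda>x. 2 powr (c * x))" and f_bot: "f \<in> O[at_bot](\<lambda>_. 1)"
  shows "(\<lambda>n. a n * f (of_int n + \<rho>)) summable_on UNIV"
proof (rule summable_on_int_if_geometric)
  have "filterlim (\<lambda>n. real_of_int n + \<rho>) at_bot at_bot" "filterlim (\<lambda>n. real_of_int n + \<rho>) at_top at_top"
    by real_asymp+
  then have bot: "(\<lambda>n. f (of_int n + \<rho>)) \<in> O[at_bot](\<lambda>n::int. 1)"
    and top: "(\<lambda>n. f (of_int n + \<rho>)) \<in> O[at_top](\<lambda>n::int. 2 powr (c * (of_int n + \<rho>)))"
    using landau_o.big.compose[OF f_bot] landau_o.big.compose[OF f_top] by blast+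
  show "(\<lambda>n. a n * f (of_int n + \<rho>)) \<in> O[at_bot](\<lambda>n. 2 powr real_of_int n)"
    using landau_o.big.mult[OF a_bot bot] by simp
  have "2 powr (- (c + 1) * real_of_int n) * 2 powr (c * (of_int n + \<rho>)) = 2 powr (c * \<rho>) * 2 powr - real_of_int n" for n :: int
    by (simp add: powr_add[symmetric] algebra_simps)
  then show "(\<lambda>n. a n * f (of_int n + \<rho>)) \<in> O[at_top](\<lambda>n. 2 powr - real_of_int n)"
    using landau_o.big.mult[OF a_top[of "c + 1"] top] by (simp only:) simp
qed

text \<open>
  On the diagonal \<open>\<phi>\<close> enters the coagulation term as \<open>\<phi> (x + 1) - 2 * \<phi> x\<close>, which is the
  fragmentation bracket at the next lattice point. With the recursion, the coagulation summand at
  \<open>n\<close> becomes a constant multiple of the fragmentation summand \<open>F (n + 1)\<close>, and the shift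
  of index does not change the sum. The decay of \<open>a\<close> at both ends gives absolute convergence for every
  test function.
\<close>

lemma dirac_comb_stationary:
  assumes k: "continuous_on {0..} k"
    and Q: "continuous_on UNIV Q" "Q 0 = 1" "closure {x. Q x \<noteq> 0} \<subseteq> {-1/3<..<1/3}"
    and \<gamma>: "continuous_on {0<..} \<gamma>" "\<And>\<xi>. \<xi> > 0 \<Longrightarrow> \<gamma> \<xi> > 0"
      "(\<lambda>x. \<gamma> (2 powr x)) \<in> O[at_bot](\<lambda>_. 1)" "(\<lambda>x. \<gamma> (2 powr x)) \<in> O[at_top](\<lambda>x. 2 powr (\<beta> * x))"
    and "\<beta> > 0"
    and a_pos: "\<And>n. a n > 0" and rec: "\<And>n. a (n + 1) = zeta k \<gamma> \<rho> n * (a n)\<^sup>2"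
    and a_top: "\<And>e. a \<in> O[at_top](\<lambda>n. 2 powr (- e * real_of_int n))"
    and a_bot: "a \<in> O[at_bot](\<lambda>n. 2 powr real_of_int n)"
  shows "stationary_solution k Q \<gamma> \<beta> (dirac_comb \<rho> a)"
proof -
  let ?g = "dirac_comb \<rho> a"
  have a_nonneg: "a n \<ge> 0" for n using a_pos[of n] by simp
  note summable = summable_against_decaying_coefficients[OF a_top a_bot]
  have "a summable_on UNIV"
    using a_top[of 1] a_bot by (intro summable_on_int_if_geometric) simp_all
  have weighted: "?g \<in> weighted_measures \<beta>"
  proof -
    have [measurable]: "weight \<beta> \<in> borel_measurable borel"
      unfolding weight_def[abs_def] by measurable
    have "weight \<beta> \<in> O[at_top](\<lambda>x. 2 powr ((\<beta> + 1) * x))"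
      unfolding weight_def[abs_def] using \<open>\<beta> > 0\<close> by real_asymp
    moreover have "weight \<beta> \<in> O[at_bot](\<lambda>_. 1)"
    proof (rule landau_o.bigI[of 2])
      have "norm (weight \<beta> x) \<le> 2 * norm (1 :: real)" if "x \<le> 0" for x
        using powr_mono[of "(\<beta> + 1) * x" 0 2] that \<open>\<beta> > 0\<close>
        by (simp add: weight_def mult_nonneg_nonpos)
      then show "eventually (\<lambda>x. norm (weight \<beta> x) \<le> 2 * norm (1 :: real)) at_bot"
        by (auto simp: eventually_at_bot_linorder)
    qed simp
    ultimately have "integrable ?g (weight \<beta>)"
      using a_nonneg by (subst integrable_dirac_comb_iff) (auto intro!: summable)
    then show ?thesis
      by (simp add: weighted_measures_def integrable_iff_bounded weight_def)
  qed
  have balance: "integrable (?g \<Otimes>\<^sub>M ?g) (coag_integrand k Q \<phi>) \<and> integrable ?g (frag_integrand \<gamma> \<phi>) \<and>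
      ln 2 / 2 * (LINT p|(?g \<Otimes>\<^sub>M ?g). coag_integrand k Q \<phi> p) - 1 / 4 * (LINT x|?g. frag_integrand \<gamma> \<phi> x) = 0"
    if "test_function \<phi>" for \<phi>
  proof -
    define F where "F n = a n * frag_integrand \<gamma> \<phi> (of_int n + \<rho>)" for n
    have \<phi>: "continuous_on UNIV \<phi>" using that by (simp add: test_function_def)
    have F: "F summable_on UNIV"
      unfolding F_def using test_function_frag_bounds[OF that \<gamma>(3,4)] by (intro summable)
    have frag: "integrable ?g (frag_integrand \<gamma> \<phi>)" "(LINT x|?g. frag_integrand \<gamma> \<phi> x) = infsum F UNIV"
      using F a_nonneg frag_integrand_measurable[OF \<gamma>(1) \<phi>]
      by (simp_all add: integrable_dirac_comb_iff integral_dirac_comb F_def[abs_def])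
    have diag: "(a n)\<^sup>2 * coag_integrand k Q \<phi> (of_int n + \<rho>, of_int n + \<rho>) = 1 / (2 * ln 2) * F (n + 1)" for n
    proof -
      define x where "x = of_int n + \<rho>"
      have "\<gamma> (2 powr (x + 1)) \<noteq> 0" using \<gamma>(2)[of "2 powr (x + 1)"] by simp
      then have "a (n + 1) * \<gamma> (2 powr (x + 1)) = ln 2 / 2 powr x * k (2 powr x) * (a n)\<^sup>2"
        by (simp add: rec zeta_def x_def)
      moreover have "F (n + 1) = a (n + 1) * \<gamma> (2 powr (x + 1)) * (\<phi> (x + 1) - 2 * \<phi> x)"
      proof -
        have "of_int (n + 1) + \<rho> = x + 1" by (simp add: x_def)
        then show ?thesis
          unfolding F_def frag_integrand_def by (simp only:) simp
      qed
      ultimately have "F (n + 1) = ln 2 / 2 powr x * k (2 powr x) * (a n)\<^sup>2 * (\<phi> (x + 1) - 2 * \<phi> x)"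
        by simp
      then show ?thesis
        unfolding x_def[symmetric] by (simp add: coag_integrand_diagonal Q(2))
    qed
    have shift: "(\<lambda>n. F (n + 1)) summable_on UNIV" "(\<Sum>\<^sub>\<infinity>n. F (n + 1)) = infsum F UNIV"
    proof -
      have bij: "bij_betw (\<lambda>n::int. n + 1) UNIV UNIV"
        by (rule bij_betw_byWitness[where f' = "\<lambda>n. n - 1"]) auto
      show "(\<lambda>n. F (n + 1)) summable_on UNIV"
        using summable_on_reindex_bij_betw[OF bij, of F] F by simp
      show "(\<Sum>\<^sub>\<infinity>n. F (n + 1)) = infsum F UNIV"
        by (rule infsum_reindex_bij_betw[OF bij])
    qed
    have diag_summable: "(\<lambda>n. (a n)\<^sup>2 * coag_integrand k Q \<phi> (of_int n + \<rho>, of_int n + \<rho>)) summable_on UNIV"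
      unfolding diag by (rule summable_on_cmult_right[OF shift(1)])
    note pair = coag_integrand_measurable[OF k Q(1) \<phi>] a_nonneg \<open>a summable_on UNIV\<close>
      coag_integrand_off_diagonal[OF Q(3)] diag_summable
    have "integrable (?g \<Otimes>\<^sub>M ?g) (coag_integrand k Q \<phi>)"
      by (rule integrable_dirac_comb_pair_diagonal[OF pair])
    moreover have "(LINT p|(?g \<Otimes>\<^sub>M ?g). coag_integrand k Q \<phi> p) = 1 / (2 * ln 2) * infsum F UNIV"
    proof -
      have "(LINT p|(?g \<Otimes>\<^sub>M ?g). coag_integrand k Q \<phi> p) =
          (\<Sum>\<^sub>\<infinity>n. (a n)\<^sup>2 * coag_integrand k Q \<phi> (of_int n + \<rho>, of_int n + \<rho>))"
        by (rule integral_dirac_comb_pair_diagonal[OF pair])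
      also have "\<dots> = 1 / (2 * ln 2) * infsum F UNIV"
        unfolding diag shift(2)[symmetric] by (rule infsum_cmult_right) (rule shift)
      finally show ?thesis .
    qed
    ultimately show ?thesis
      using frag by simp
  qed
  have "((\<lambda>s. LINT x|?g. \<phi> x) has_real_derivative
      ln 2 / 2 * (LINT p|(?g \<Otimes>\<^sub>M ?g). coag_integrand k Q \<phi> p) - 1 / 4 * (LINT x|?g. frag_integrand \<gamma> \<phi> x))
      (at t within {0..T})" if "test_function \<phi>" for \<phi> t T
    using balance[OF that] by (simp only: DERIV_const)
  with weighted balance show ?thesis
    unfolding stationary_solution_def weak_solution_def weakly_continuous_on_def
    by (intro allI impI conjI ballI continuous_on_const refl) blast+
qed

section \<open>The coefficients of the recursion for the given kernels\<close>

text \<open>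
  An error of order \<open>x\<^sup>p\<close> in a function with a positive limit gives an error of the same order in its
  logarithm, since \<open>ln (1 + r)\<close> differs from \<open>r\<close> by at most \<open>2 * r\<^sup>2\<close> for small \<open>r\<close>.
\<close>

lemma ln_diff_bigo_at_0:
  fixes f :: "real \<Rightarrow> real"
  assumes f: "(\<lambda>x. f x - c) \<in> O[at_right 0](\<lambda>x. x powr p)" and "c > 0" "p > 0"
  shows "(\<lambda>x. ln (f x) - ln c) \<in> O[at_right 0](\<lambda>x. x powr p)"
proof -
  obtain C where "C > 0" and C: "eventually (\<lambda>x. \<bar>f x - c\<bar> \<le> C * x powr p) (at_right 0)"
    using f by (auto elim!: landau_o.bigE)
  have "((\<lambda>x. C * x powr p) \<longlongrightarrow> 0) (at_right 0)"
    using \<open>p > 0\<close> by real_asymp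
  then have "eventually (\<lambda>x. C * x powr p < c / 2) (at_right 0)"
    using \<open>c > 0\<close> by (intro order_tendstoD) auto
  with C have "eventually (\<lambda>x. \<bar>ln (f x) - ln c\<bar> \<le> 2 * C / c * x powr p) (at_right 0)"
  proof eventually_elim
    case (elim x)
    define r where "r = (f x - c) / c"
    have r: "\<bar>r\<bar> \<le> 1 / 2" "\<bar>r\<bar> \<le> C * x powr p / c"
      using elim \<open>c > 0\<close> by (auto simp: r_def abs_divide field_simps)
    have "f x = c * (1 + r)" using \<open>c > 0\<close> by (simp add: r_def field_simps)
    then have "ln (f x) - ln c = ln (1 + r)"
      using r(1) \<open>c > 0\<close> by (subst \<open>f x = _\<close>, subst ln_mult) auto
    moreover have "\<bar>ln (1 + r) - r\<bar> \<le> 2 * r\<^sup>2"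
      using abs_ln_one_plus_x_minus_x_bound[OF r(1)] .
    moreover have "2 * r\<^sup>2 \<le> \<bar>r\<bar>"
    proof -
      have "\<bar>r\<bar> * \<bar>r\<bar> \<le> \<bar>r\<bar> * (1 / 2)" by (intro mult_left_mono r(1)) simp
      then show ?thesis by (simp add: power2_eq_square)
    qed
    ultimately have "\<bar>ln (f x) - ln c\<bar> \<le> 2 * \<bar>r\<bar>" by linarith
    also have "\<dots> \<le> 2 * C / c * x powr p" using r(2) by simp
    finally show ?case .
  qed
  then show ?thesis by (intro landau_o.bigI[of "2 * C / c"]) (use \<open>C > 0\<close> \<open>c > 0\<close> in auto)
qed

lemma ln_ratio_tendsto_0_if_asymp_equiv:
  fixes f g :: "'a \<Rightarrow> real"
  assumes "f \<sim>[F] g" and "\<And>x. f x > 0" and "\<And>x. g x > 0"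
  shows "((\<lambda>x. ln (f x) - ln (g x)) \<longlongrightarrow> 0) F"
proof -
  have "((\<lambda>x. f x / g x) \<longlongrightarrow> 1) F"
    using assms(2) by (intro asymp_equivD_strong[OF assms(1)] always_eventually) (auto simp: less_imp_neq[symmetric])
  then have "((\<lambda>x. ln (f x / g x)) \<longlongrightarrow> ln 1) F"
    by (intro tendsto_ln) auto
  moreover have "ln (f x / g x) = ln (f x) - ln (g x)" for x
    using assms(2)[of x] assms(3)[of x] by (simp add: ln_div)
  ultimately show ?thesis by simp
qed

lemma zeta_at_top:
  assumes k: "k \<sim>[at_top] (\<lambda>\<xi>. \<xi> powr (\<alpha> + 1))" and \<gamma>: "\<gamma> \<sim>[at_top] (\<lambda>\<xi>. \<xi> powr \<beta>)"
  shows "zeta k \<gamma> \<rho> \<sim>[at_top] (\<lambda>n. ln 2 * 2 powr ((\<alpha> - \<beta>) * \<rho> - \<beta>) * 2 powr (- (\<beta> - \<alpha>) * of_int n))"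
proof -
  have lim: "filterlim (\<lambda>n::int. 2 powr (of_int n + \<rho>)) at_top at_top"
    "filterlim (\<lambda>n::int. 2 powr (of_int n + \<rho> + 1)) at_top at_top"
    by real_asymp+
  have "(\<lambda>n. ln 2 / 2 powr (of_int n + \<rho>) * (k (2 powr (of_int n + \<rho>)) / \<gamma> (2 powr (of_int n + \<rho> + 1)))) \<sim>[at_top]
      (\<lambda>n::int. ln 2 / 2 powr (of_int n + \<rho>) *
         ((2 powr (of_int n + \<rho>)) powr (\<alpha> + 1) / (2 powr (of_int n + \<rho> + 1)) powr \<beta>))"
    by (intro asymp_equiv_mult asymp_equiv_divide asymp_equiv_refl
        asymp_equiv_compose'[OF k lim(1)] asymp_equiv_compose'[OF \<gamma> lim(2)])
  moreover have "ln 2 / 2 powr (y + \<rho>) * ((2 powr (y + \<rho>)) powr (\<alpha> + 1) / (2 powr (y + \<rho> + 1)) powr \<beta>) =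
      ln 2 * 2 powr ((\<alpha> - \<beta>) * \<rho> - \<beta>) * 2 powr (- (\<beta> - \<alpha>) * y)" for y :: real
  proof -
    have "ln 2 / 2 powr x * ((2 powr x) powr (\<alpha> + 1) / (2 powr (x + 1)) powr \<beta>) =
        ln 2 * 2 powr (- x + x * (\<alpha> + 1) - (x + 1) * \<beta>)" for x :: real
      unfolding powr_powr powr_diff powr_add[of 2 "- x"] powr_minus by (simp add: divide_inverse)
    then show ?thesis
      by (simp only: mult.assoc powr_add[symmetric]) (simp add: algebra_simps)
  qed
  ultimately show ?thesis
    by (simp only: zeta_def[abs_def])
qed

text \<open>
  Up to the explicit factor \<open>2\<^sup>-\<^sup>n\<close>, \<open>ln \<zeta>\<close> is a difference of the logarithms of the two kernels at
  sizes proportional to \<open>2\<^sup>n\<close>, so the weaker of the two error exponents decides.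
\<close>

lemma zeta_at_bot:
  assumes k: "(\<lambda>\<xi>. k \<xi> - k0) \<in> O[at_right 0](\<lambda>\<xi>. \<xi> powr p1)" "\<And>\<xi>. \<xi> > 0 \<Longrightarrow> k \<xi> > 0" "k0 > 0" "p1 > 0"
    and \<gamma>: "(\<lambda>\<xi>. \<gamma> \<xi> - \<gamma>0) \<in> O[at_right 0](\<lambda>\<xi>. \<xi> powr p2)" "\<And>\<xi>. \<xi> > 0 \<Longrightarrow> \<gamma> \<xi> > 0" "\<gamma>0 > 0" "p2 > 0"
  shows "(\<lambda>n. ln (zeta k \<gamma> \<rho> n) - ln (ln 2 * 2 powr - \<rho> * k0 / \<gamma>0 * 2 powr - real_of_int n))
    \<in> O[at_bot](\<lambda>n. 2 powr (min p1 p2 * of_int n))"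
proof -
  define q where "q = min p1 p2"
  have comp: "(\<lambda>n::int. ln (f (2 powr (of_int n + s))) - ln c) \<in> O[at_bot](\<lambda>n. 2 powr (q * of_int n))"
    if f: "(\<lambda>\<xi>. f \<xi> - c) \<in> O[at_right 0](\<lambda>\<xi>. \<xi> powr p)" "c > 0" "p > 0" "q \<le> p" for f c p s
  proof -
    have "filterlim (\<lambda>n::int. 2 powr (of_int n + s)) (at_right 0) at_bot"
      by real_asymp
    from landau_o.big.compose[OF ln_diff_bigo_at_0[OF f(1-3)] this]
    have "(\<lambda>n::int. ln (f (2 powr (of_int n + s))) - ln c) \<in> O[at_bot](\<lambda>n. (2 powr (of_int n + s)) powr p)" .
    also have "(\<lambda>n::int. (2 powr (of_int n + s)) powr p) \<in> O[at_bot](\<lambda>n. 2 powr (q * of_int n))"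
    proof (rule landau_o.bigI[of "2 powr (s * p)"])
      have "(2 powr (of_int n + s)) powr p \<le> 2 powr (s * p) * 2 powr (q * of_int n)" if "n \<le> 0" for n :: int
      proof -
        have "of_int n * p \<le> of_int n * q"
          using that \<open>q \<le> p\<close> by (intro mult_left_mono_neg) auto
        then show ?thesis
          by (simp add: powr_powr powr_add[symmetric] algebra_simps)
      qed
      then show "eventually (\<lambda>n::int. norm ((2 powr (of_int n + s)) powr p) \<le>
          2 powr (s * p) * norm (2 powr (q * of_int n))) at_bot"
        by (auto simp: eventually_at_bot_linorder)
    qed simp
    finally show ?thesis .
  qed
  have "ln (zeta k \<gamma> \<rho> n) - ln (ln 2 * 2 powr - \<rho> * k0 / \<gamma>0 * 2 powr - real_of_int n) =
      (ln (k (2 powr (of_int n + \<rho>))) - ln k0) - (ln (\<gamma> (2 powr (of_int n + (\<rho> + 1)))) - ln \<gamma>0)" for n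
  proof -
    have "zeta k \<gamma> \<rho> n = ln 2 * 2 powr (- \<rho> - real_of_int n) * k (2 powr (of_int n + \<rho>)) / \<gamma> (2 powr (of_int n + (\<rho> + 1)))"
      by (simp add: zeta_def powr_diff powr_minus powr_add add.assoc divide_inverse mult_ac)
    moreover have "ln 2 * 2 powr - \<rho> * k0 / \<gamma>0 * 2 powr - real_of_int n =
        ln 2 * 2 powr (- \<rho> - real_of_int n) * k0 / \<gamma>0"
      by (simp add: powr_diff powr_minus divide_inverse)
    moreover have "k (2 powr (of_int n + \<rho>)) > 0" "\<gamma> (2 powr (of_int n + (\<rho> + 1))) > 0"
      using k(2) \<gamma>(2) by auto
    ultimately show ?thesis
      using \<open>k0 > 0\<close> \<open>\<gamma>0 > 0\<close> by (simp add: ln_mult ln_div algebra_simps)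
  qed
  moreover have "(\<lambda>n::int. (ln (k (2 powr (of_int n + \<rho>))) - ln k0) - (ln (\<gamma> (2 powr (of_int n + (\<rho> + 1)))) - ln \<gamma>0))
      \<in> O[at_bot](\<lambda>n. 2 powr (q * of_int n))"
    by (intro sum_in_bigo comp[OF k(1,3,4)] comp[OF \<gamma>(1,3,4)]) (simp_all add: q_def)
  ultimately show ?thesis by (simp add: q_def)
qed

lemma quadratic_coefficient_unique:
  fixes a :: "int \<Rightarrow> real"
  assumes "(\<lambda>n. a n - c * (2 powr of_int n + A * 2 powr (2 * of_int n))) \<in> o[at_bot](\<lambda>n. 2 powr (2 * of_int n))"
    and "(\<lambda>n. a n - c * (2 powr of_int n + B * 2 powr (2 * of_int n))) \<in> o[at_bot](\<lambda>n. 2 powr (2 * of_int n))"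
    and "c \<noteq> 0"
  shows "A = B"
proof (rule ccontr)
  assume "A \<noteq> B"
  have "(\<lambda>n::int. c * (B - A) * 2 powr (2 * of_int n)) \<in> o[at_bot](\<lambda>n. 2 powr (2 * of_int n))"
    using sum_in_smallo(2)[OF assms(1,2)] by (simp add: algebra_simps)
  then have "(\<lambda>n::int. 2 powr (2 * of_int n) :: real) \<in> o[at_bot](\<lambda>n. 2 powr (2 * of_int n))"
    using \<open>A \<noteq> B\<close> \<open>c \<noteq> 0\<close> by (subst (asm) landau_o.small.cmult_in_iff) auto
  then show False
    by (simp add: landau_o.small_refl_iff)
qed

lemma decay_rate_unique:
  fixes a T :: "int \<Rightarrow> real"
  assumes "a \<sim>[at_top] (\<lambda>n. T n * exp (- A * 2 powr of_int n))"
    and "a \<sim>[at_top] (\<lambda>n. T n * exp (- B * 2 powr of_int n))"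
    and T: "\<And>n. T n > 0"
  shows "A = B"
proof -
  have "((\<lambda>n. ln (T n * exp (- A * 2 powr of_int n)) - ln (T n * exp (- B * 2 powr of_int n))) \<longlongrightarrow> 0) at_top"
    using T by (intro ln_ratio_tendsto_0_if_asymp_equiv asymp_equiv_trans[OF asymp_equiv_symI[OF assms(1)] assms(2)]) auto
  moreover have "ln (T n * exp (- A * 2 powr of_int n)) - ln (T n * exp (- B * 2 powr of_int n)) = (B - A) * 2 powr of_int n" for n
    using T[of n] by (simp add: ln_mult algebra_simps)
  ultimately have "((\<lambda>n::int. (B - A) * 2 powr of_int n) \<longlongrightarrow> 0) at_top"
    by simp
  moreover have "((\<lambda>n::int. 2 powr - of_int n :: real) \<longlongrightarrow> 0) at_top"
    by real_asymp
  ultimately have "((\<lambda>n::int. (B - A) * 2 powr of_int n * 2 powr - of_int n) \<longlongrightarrow> 0 * 0) at_top"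
    by (rule tendsto_mult)
  then have "((\<lambda>n::int. B - A) \<longlongrightarrow> 0) at_top"
    by (simp add: powr_minus mult.assoc)
  then show ?thesis
    by (simp add: tendsto_const_iff)
qed


section \<open>Existence, uniqueness and asymptotics of the stationary Dirac combs\<close>

theorem proposition4p1:
  fixes \<alpha> \<beta> \<alpha>_bar \<beta>_bar k0 \<gamma>0 \<rho> M :: real
    and k Q \<gamma> :: "real \<Rightarrow> real"
  assumes "0 < \<alpha>" "\<alpha> < 1" "1 < \<beta>" "\<beta> < 2" "\<alpha>_bar > 1" "\<beta>_bar > 1" "k0 > 0" "\<gamma>0 > 0"
    and "continuous_on {0..} k" "\<And>\<xi>. \<xi> \<ge> 0 \<Longrightarrow> k \<xi> > 0"
    and "k \<sim>[at_top] (\<lambda>\<xi>. \<xi> powr (\<alpha> + 1))"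
    and "(\<lambda>\<xi>. k \<xi> - k0) \<in> O[at_right 0](\<lambda>\<xi>. \<xi> powr \<alpha>_bar)"
    and "continuous_on UNIV Q" "\<And>x. Q x \<ge> 0" "Q 0 = 1" "\<And>x. Q (- x) = Q x"
    and "closure {x. Q x \<noteq> 0} \<subseteq> {-1/3<..<1/3}"
    and "continuous_on {0<..} \<gamma>" "\<And>\<xi>. \<xi> > 0 \<Longrightarrow> \<gamma> \<xi> > 0"
    and "\<gamma> \<sim>[at_top] (\<lambda>\<xi>. \<xi> powr \<beta>)"
    and "(\<lambda>\<xi>. \<gamma> \<xi> - \<gamma>0) \<in> O[at_right 0](\<lambda>\<xi>. \<xi> powr \<beta>_bar)"
    and "0 \<le> \<rho>" "\<rho> < 1" "M > 0"
  shows "(\<exists>!a. coefficient_family k \<gamma> \<rho> M a) \<and>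
    (\<forall>a. coefficient_family k \<gamma> \<rho> M a \<longrightarrow>
       (\<exists>!A0. (\<lambda>n::int. a n - a_minus_infty k0 \<gamma>0 \<rho> *
                   (2 powr real_of_int n + A0 * 2 powr (2 * real_of_int n)))
                \<in> o[at_bot](\<lambda>n. 2 powr (2 * real_of_int n))) \<and>
       (\<exists>!A_M. A_M > 0 \<and>
          a \<sim>[at_top] (\<lambda>n. a_infty \<alpha> \<beta> \<rho> * 2 powr ((\<beta> - \<alpha>) * real_of_int n) *
                              exp (- A_M * 2 powr real_of_int n))) \<and>
       stationary_solution k Q \<gamma> \<beta> (dirac_comb \<rho> a) \<and>
       integrable (dirac_comb \<rho> a) (\<lambda>x. 2 powr x) \<and>
       (LINT x|dirac_comb \<rho> a. 2 powr x) = (\<Sum>\<^sub>\<infinity>n. 2 powr (real_of_int n + \<rho>) * a n) \<and>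
       (\<Sum>\<^sub>\<infinity>n. 2 powr (real_of_int n + \<rho>) * a n) = M)"
proof -
  define c_top where "c_top = ln 2 * 2 powr ((\<alpha> - \<beta>) * \<rho> - \<beta>)"
  define c_bot where "c_bot = ln 2 * 2 powr - \<rho> * k0 / \<gamma>0"
  have a_infty: "2 powr (\<beta> - \<alpha>) / c_top = a_infty \<alpha> \<beta> \<rho>"
  proof -
    have "1 / 2 powr ((\<alpha> - \<beta>) * \<rho> - \<beta>) = 2 powr (\<beta> - (\<alpha> - \<beta>) * \<rho>)"
      by (simp add: powr_minus[symmetric] flip: inverse_eq_divide)
    then have "2 powr (\<beta> - \<alpha>) / c_top = inverse (ln 2) * (2 powr (\<beta> - \<alpha>) * 2 powr (\<beta> - (\<alpha> - \<beta>) * \<rho>))"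
      by (simp add: c_top_def divide_inverse)
    also have "\<dots> = a_infty \<alpha> \<beta> \<rho>"
      by (simp add: a_infty_def powr_add[symmetric] algebra_simps)
    finally show ?thesis .
  qed
  have a_minus_infty: "2 / c_bot = a_minus_infty k0 \<gamma>0 \<rho>"
    by (simp add: c_bot_def a_minus_infty_def powr_add powr_minus field_simps)
  have pos: "c_top > 0" "c_bot > 0" "a_infty \<alpha> \<beta> \<rho> > 0" "a_minus_infty k0 \<gamma>0 \<rho> > 0"
    using \<open>k0 > 0\<close> \<open>\<gamma>0 > 0\<close> by (auto simp: c_top_def c_bot_def a_infty_def a_minus_infty_def)
  have zeta_pos: "zeta k \<gamma> \<rho> n > 0" for n
    using assms(10,19) by (simp add: zeta_def)
  interpret squaring_recursion "zeta k \<gamma> \<rho>" c_top "\<beta> - \<alpha>" c_bot "min \<alpha>_bar \<beta>_bar"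
  proof
    show "((\<lambda>n. ln (zeta k \<gamma> \<rho> n) - ln (c_top * 2 powr (- (\<beta> - \<alpha>) * of_int n))) \<longlongrightarrow> 0) at_top"
      using zeta_at_top[OF assms(11,20), of \<rho>] zeta_pos pos
      by (intro ln_ratio_tendsto_0_if_asymp_equiv) (auto simp: c_top_def)
    show "(\<lambda>n. ln (zeta k \<gamma> \<rho> n) - ln (c_bot * 2 powr - real_of_int n))
        \<in> O[at_bot](\<lambda>n. 2 powr (min \<alpha>_bar \<beta>_bar * of_int n))"
      unfolding c_bot_def using assms by (intro zeta_at_bot) auto
  qed (use zeta_pos pos assms in auto)
  \<comment> \<open>The mass is counted with the weight \<open>2\<^sup>n\<^sup>+\<^sup>\<rho>\<close> instead of \<open>2\<^sup>n\<close>, which rescales it by \<open>2\<^sup>\<rho>\<close>.\<close>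
  have family_iff: "coefficient_family k \<gamma> \<rho> M a \<longleftrightarrow>
      solution a \<and> bounded (range a) \<and> ((\<lambda>n. 2 powr real_of_int n * a n) has_sum M / 2 powr \<rho>) UNIV" for a
  proof -
    have "((\<lambda>n. 2 powr (real_of_int n + \<rho>) * a n) has_sum M) UNIV \<longleftrightarrow>
        ((\<lambda>n. 2 powr \<rho> * (2 powr real_of_int n * a n)) has_sum 2 powr \<rho> * (M / 2 powr \<rho>)) UNIV"
      by (simp add: powr_add mult_ac)
    also have "\<dots> \<longleftrightarrow> ((\<lambda>n. 2 powr real_of_int n * a n) has_sum M / 2 powr \<rho>) UNIV"
      by (subst has_sum_cmult_right_iff) simp_all
    finally show ?thesis by (auto simp: coefficient_family_def solution_def)
  qed
  have \<gamma>_top: "(\<lambda>x. \<gamma> (2 powr x)) \<in> O[at_top](\<lambda>x. 2 powr (\<beta> * x))"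
  proof -
    have "filterlim (\<lambda>x::real. 2 powr x) at_top at_top" by real_asymp
    from landau_o.big.compose[OF asymp_equiv_imp_bigo[OF assms(20)] this]
    show ?thesis by (simp add: powr_powr mult.commute)
  qed
  have \<gamma>_bot: "(\<lambda>x. \<gamma> (2 powr x)) \<in> O[at_bot](\<lambda>_. 1)"
  proof -
    have "(\<lambda>\<xi>. \<xi> powr \<beta>_bar) \<in> O[at_right 0](\<lambda>_. 1 :: real)"
      using \<open>\<beta>_bar > 1\<close> by real_asymp
    then have "(\<lambda>\<xi>. \<gamma> \<xi> - \<gamma>0) \<in> O[at_right 0](\<lambda>_. 1)"
      using assms(21) landau_o.big_trans by blast
    from sum_in_bigo(1)[OF this, of "\<lambda>_. \<gamma>0"] have "\<gamma> \<in> O[at_right 0](\<lambda>_. 1)" by simp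
    moreover have "filterlim (\<lambda>x::real. 2 powr x) (at_right 0) at_bot" by real_asymp
    ultimately show ?thesis using landau_o.big.compose by blast
  qed
  show ?thesis
  proof (intro conjI allI impI)
    show "\<exists>!a. coefficient_family k \<gamma> \<rho> M a"
      unfolding family_iff using \<open>M > 0\<close> by (intro unique_bounded_solution_of_given_mass) simp
  next
    fix a assume family: "coefficient_family k \<gamma> \<rho> M a"
    then have a: "solution a" "bounded (range a)" by (simp_all add: family_iff)
    have mass: "((\<lambda>n. 2 powr (real_of_int n + \<rho>) * a n) has_sum M) UNIV"
      and rec: "\<And>n. a (n + 1) = zeta k \<gamma> \<rho> n * (a n)\<^sup>2"
      using family by (simp_all add: coefficient_family_def)
    have a_nonneg: "a n \<ge> 0" for n using solution_pos[OF a(1), of n] by simp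
    show "\<exists>!A0. (\<lambda>n::int. a n - a_minus_infty k0 \<gamma>0 \<rho> *
                   (2 powr real_of_int n + A0 * 2 powr (2 * real_of_int n)))
                \<in> o[at_bot](\<lambda>n. 2 powr (2 * real_of_int n))"
    proof (rule ex_ex1I)
      show "\<exists>A0. (\<lambda>n::int. a n - a_minus_infty k0 \<gamma>0 \<rho> *
                   (2 powr real_of_int n + A0 * 2 powr (2 * real_of_int n)))
                \<in> o[at_bot](\<lambda>n. 2 powr (2 * real_of_int n))"
        using solution_at_bot[OF a(1)] unfolding a_minus_infty .
    qed (rule quadratic_coefficient_unique, assumption, assumption, use pos in simp)
    obtain A where A: "A > 0" "a \<sim>[at_top] (\<lambda>n. a_infty \<alpha> \<beta> \<rho> * 2 powr ((\<beta> - \<alpha>) * real_of_int n) *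
                              exp (- A * 2 powr real_of_int n))"
      using solution_at_top_decay[OF a] unfolding a_infty by blast
    show "\<exists>!A_M. A_M > 0 \<and>
          a \<sim>[at_top] (\<lambda>n. a_infty \<alpha> \<beta> \<rho> * 2 powr ((\<beta> - \<alpha>) * real_of_int n) *
                              exp (- A_M * 2 powr real_of_int n))"
    proof (rule ex1I[of _ A])
      fix B assume B: "B > 0 \<and> a \<sim>[at_top] (\<lambda>n. a_infty \<alpha> \<beta> \<rho> * 2 powr ((\<beta> - \<alpha>) * real_of_int n) *
                              exp (- B * 2 powr real_of_int n))"
      show "B = A"
        by (rule decay_rate_unique[OF conjunct2[OF B] A(2)]) (use pos in simp)
    qed (use A in blast)
    show "stationary_solution k Q \<gamma> \<beta> (dirac_comb \<rho> a)"
      using assms(3) solution_pos[OF a(1)] rec solution_bigo_at_bot[OF a(1)]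
        solution_bigo_at_top[OF A(2)[folded a_infty] A(1)]
      by (intro dirac_comb_stationary assms \<gamma>_top \<gamma>_bot) auto
    show "integrable (dirac_comb \<rho> a) (\<lambda>x. 2 powr x)"
      using mass a_nonneg by (subst integrable_dirac_comb_iff) (auto simp: summable_on_def mult.commute)
    show "(LINT x|dirac_comb \<rho> a. 2 powr x) = (\<Sum>\<^sub>\<infinity>n. 2 powr (real_of_int n + \<rho>) * a n)"
      using a_nonneg by (subst integral_dirac_comb) (auto simp: mult.commute)
    show "(\<Sum>\<^sub>\<infinity>n. 2 powr (real_of_int n + \<rho>) * a n) = M"
      using mass by (rule infsumI)
  qed
qed

end
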